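(* Let $X:=H^1(\mathbb{T}^2)\times L^2(\mathbb{T}^2)$ and let $A$ be the operator on $X$ with domain $D(A)=H^2(\mathbb{T}^2)\times H^1(\mathbb{T}^2)$ given by $$A\begin{pmatrix}u\\ v\end{pmatrix}=\begin{pmatrix}-v\\-\Delta u-e^{iy}\,\partial_xu\end{pmatrix}.$$ Let $(T(t))_{t\in\mathbb{R}}$ be the $C_0$-group generated by $-A$ and let $(S(t))_{t\in\mathbb{R}}$, $S(t)=T(-t)$, be the one generated by $A$. Then $\omega_0(T)=\omega_0(S)=\frac12$. Moreover, there exists a $C\ge0$ such that $$\|T(t)\|_{\mathcal{L}(X)}\le C(1+|t|)e^{|t|/2}\qquad(t\in\mathbb{R}).$$
   Context: $\mathbb{T}^2=[0,2\pi]^2$ is the two-dimensional torus with the usual identification modulo $2\pi$, with coordinates $(x,y)$; functions are complex valued. For $s\in\mathbb{R}$, $H^s(\mathbb{T}^2)=W^{2,s}(\mathbb{T}^2)$ is the $L^2$-based Sobolev space with norm $\|f\|_{H^s(\mathbb{T}^2)}=(|\hat f(0)|^2+\sum_{k\in\mathbb{Z}^2\setminus\{0\}}|k|^{2s}|\hat f(k)|^2)^{1/2}$, where $\hat f(k)=\frac1{2\pi}\int_{\mathbb{T}^2}e^{-ik\cdot(x,y)}f(x,y)\,dx\,dy$ are the Fourier coefficients. $\Delta$ is the Laplacian on $L^2(\mathbb{T}^2)$ with domain $H^2(\mathbb{T}^2)$. The Cauchy problem $\frac{d}{dt}(u,v)^\top+A(u,v)^\top=0$ is the first-order form of the perturbed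 wave equation $u_{tt}=u_{xx}+u_{yy}+e^{iy}u_x$ on $\mathbb{T}^2$; $-A$ is a bounded perturbation of a group generator and generates a $C_0$-group on $X$. For a $C_0$-semigroup $T$, $\omega_0(T)=\inf\{\omega\in\mathbb{R}:\exists M\ge0\ \forall t\ge0\ \|T(t)\|_{\mathcal{L}(X)}\le Me^{\omega t}\}$; for the groups $T$ and $S$ this refers to the semigroups $(T(t))_{t\ge0}$ and $(S(t))_{t\ge0}$. *)

theory Defs
  imports "HOL-Analysis.Analysis"
begin

class complex_normed_vector = real_normed_vector +
  fixes scaleC :: "complex \<Rightarrow> 'a \<Rightarrow> 'a"  (infixr "*\<^sub>C" 75)
  assumes scaleC_add_right: "c *\<^sub>C (x + y) = c *\<^sub>C x + c *\<^sub>C y"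
    and scaleC_add_left: "(c + d) *\<^sub>C x = c *\<^sub>C x + d *\<^sub>C x"
    and scaleC_scaleC: "c *\<^sub>C d *\<^sub>C x = (c * d) *\<^sub>C x"
    and scaleC_of_real: "of_real r *\<^sub>C x = r *\<^sub>R x"
    and norm_scaleC: "norm (c *\<^sub>C x) = cmod c * norm x"

instantiation prod :: (complex_normed_vector, complex_normed_vector) complex_normed_vector
begin

definition scaleC_prod :: "complex \<Rightarrow> 'a \<times> 'b \<Rightarrow> 'a \<times> 'b"
  where "c *\<^sub>C p = (c *\<^sub>C fst p, c *\<^sub>C snd p)"

instance
proof
  fix c d :: complex and r :: real and x y :: "'a \<times> 'b"
  show "norm (c *\<^sub>C x) = cmod c * norm x"
    by (simp add: scaleC_prod_def norm_prod_def norm_scaleC power_mult_distrib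
        flip: distrib_left) (simp add: real_sqrt_mult)
qed (simp_all add: scaleC_prod_def scaleC_add_right scaleC_add_left scaleC_scaleC scaleC_of_real
      prod_eq_iff)

end


text \<open>\<open>\<Rightarrow>\<^sub>L\<close> only gives real linearity, so complex linearity is demanded separately. Unbounded
  operators, in particular generators, are represented by their graphs.\<close>

definition C0_group :: "(real \<Rightarrow> 'a::complex_normed_vector \<Rightarrow>\<^sub>L 'a) \<Rightarrow> bool" where
  "C0_group T \<longleftrightarrow>
     T 0 = id_blinfun \<and>
     (\<forall>s t. T (s + t) = T s o\<^sub>L T t) \<and>
     (\<forall>t c x. T t (c *\<^sub>C x) = c *\<^sub>C T t x) \<and>
     (\<forall>x. continuous_on UNIV (\<lambda>t. T t x))"

definition generator :: "(real \<Rightarrow> 'a::complex_normed_vector \<Rightarrow>\<^sub>L 'a) \<Rightarrow> ('a \<times> 'a) set" where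
  "generator T = {(x, y). ((\<lambda>h. (T h x - x) /\<^sub>R h) \<longlongrightarrow> y) (at 0)}"

text \<open>Extended real, since the infimum may be \<open>-\<infinity>\<close>.\<close>

definition growth_bound :: "(real \<Rightarrow> 'a::complex_normed_vector \<Rightarrow>\<^sub>L 'a) \<Rightarrow> ereal" where
  "growth_bound T =
     Inf (ereal ` {\<omega>. \<exists>M\<ge>0. \<forall>t\<ge>0. norm (T t) \<le> M * exp (\<omega> * t)})"


text \<open>Functions on the torus are represented by their values on the closed square; what they do
  elsewhere is irrelevant.\<close>

definition torus :: "(real \<times> real) measure" where
  "torus = restrict_space lborel ({0..2 * pi} \<times> {0..2 * pi})"

definition sq_integrable :: "(real \<times> real \<Rightarrow> complex) \<Rightarrow> bool" where
  "sq_integrable f \<longleftrightarrow> f \<in> borel_measurable torus \<and> integrable torus (\<lambda>z. (cmod (f z))\<^sup>2)"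

lemma space_torus: "space torus = {0..2 * pi} \<times> {0..2 * pi}"
  by (simp add: torus_def space_restrict_space)

lemma torus_square: "{0..2 * pi} \<times> {0..2 * pi} = cbox (0::real, 0::real) (2 * pi, 2 * pi)"
  by (auto simp: cbox_Pair_eq)

lemma mem_cbox_Pair:
  "(x, y) \<in> cbox (a::real, b::real) (c, d) \<longleftrightarrow> a \<le> x \<and> x \<le> c \<and> b \<le> y \<and> y \<le> d"
  by (auto simp: mem_box Basis_prod_def)

lemma mem_box_Pair:
  "(x, y) \<in> box (a::real, b::real) (c, d) \<longleftrightarrow> a < x \<and> x < c \<and> b < y \<and> y < d"
  by (auto simp: mem_box Basis_prod_def)

interpretation torus: finite_measure torus
proof
  show "emeasure torus (space torus) \<noteq> \<infinity>"
    unfolding torus_def torus_square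
    by (simp add: emeasure_restrict_space space_restrict_space emeasure_lborel_cbox_eq)
qed

lemma borel_measurable_torusI: "f \<in> borel_measurable borel \<Longrightarrow> f \<in> borel_measurable torus"
  unfolding torus_def by (simp add: measurable_restrict_space1)

lemma sq_integrable_measurable [measurable_dest]:
  "sq_integrable f \<Longrightarrow> f \<in> borel_measurable torus"
  by (simp add: sq_integrable_def)

lemma sq_integrable_zero: "sq_integrable (\<lambda>_. 0)"
  by (simp add: sq_integrable_def)

lemma sq_norm_add_le: "(norm (a + b))\<^sup>2 \<le> 2 * (norm a)\<^sup>2 + 2 * (norm (b::'a::real_normed_vector))\<^sup>2"
proof -
  have "(norm (a + b))\<^sup>2 \<le> (norm a + norm b)\<^sup>2"
    by (intro power_mono norm_triangle_ineq norm_ge_zero)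
  also have "\<dots> \<le> 2 * (norm a)\<^sup>2 + 2 * (norm b)\<^sup>2"
    using sum_squares_bound[of "norm a" "norm b"] by (simp add: power2_sum)
  finally show ?thesis .
qed

lemma sq_norm_add_le_weighted:
  fixes u v :: "'a::real_normed_vector"
  assumes ab: "a > 0" "b > 0"
  shows "(norm (u + v))\<^sup>2 \<le> (1 + b / a) * (norm u)\<^sup>2 + (1 + a / b) * (norm v)\<^sup>2"
proof -
  define s t where "s = norm u" and "t = norm v"
  have "(norm (u + v))\<^sup>2 \<le> (s + t)\<^sup>2"
    unfolding s_def t_def by (intro power_mono norm_triangle_ineq norm_ge_zero)
  moreover have "(1 + b / a) * s\<^sup>2 + (1 + a / b) * t\<^sup>2 - (s + t)\<^sup>2 = (b * s - a * t)\<^sup>2 / (a * b)"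
    using ab by (simp add: field_simps power2_eq_square)
  moreover have "(b * s - a * t)\<^sup>2 / (a * b) \<ge> 0" using ab by simp
  ultimately show ?thesis unfolding s_def t_def by linarith
qed

lemma sq_integrable_bounded_mult:
  assumes f: "sq_integrable f" and [measurable]: "g \<in> borel_measurable torus"
    and b: "\<And>z. cmod (g z) \<le> B"
  shows "sq_integrable (\<lambda>z. g z * f z)"
proof -
  have [measurable]: "f \<in> borel_measurable torus" using f by (rule sq_integrable_measurable)
  have "integrable torus (\<lambda>z. (cmod (g z * f z))\<^sup>2)"
  proof (rule Bochner_Integration.integrable_bound)
    show "integrable torus (\<lambda>z. B\<^sup>2 * (cmod (f z))\<^sup>2)"
      using f by (simp add: sq_integrable_def)
    show "AE z in torus. norm ((cmod (g z * f z))\<^sup>2) \<le> norm (B\<^sup>2 * (cmod (f z))\<^sup>2)"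
      using b by (auto simp: norm_mult power_mult_distrib intro!: mult_right_mono power_mono)
  qed simp
  then show ?thesis by (simp add: sq_integrable_def)
qed

lemma sq_integrable_cmult: "sq_integrable f \<Longrightarrow> sq_integrable (\<lambda>z. c * f z)"
  by (rule sq_integrable_bounded_mult[where B = "cmod c"]) auto

lemma sq_integrable_add:
  assumes f: "sq_integrable f" and g: "sq_integrable g"
  shows "sq_integrable (\<lambda>z. f z + g z)"
proof -
  have [measurable]: "f \<in> borel_measurable torus" "g \<in> borel_measurable torus"
    using assms by (auto dest: sq_integrable_measurable)
  have "integrable torus (\<lambda>z. (cmod (f z + g z))\<^sup>2)"
  proof (rule Bochner_Integration.integrable_bound)
    show "integrable torus (\<lambda>z. 2 * (cmod (f z))\<^sup>2 + 2 * (cmod (g z))\<^sup>2)"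
      using f g by (simp add: sq_integrable_def)
    show "AE z in torus. norm ((cmod (f z + g z))\<^sup>2) \<le> norm (2 * (cmod (f z))\<^sup>2 + 2 * (cmod (g z))\<^sup>2)"
      using sq_norm_add_le by auto
  qed simp
  then show ?thesis by (simp add: sq_integrable_def)
qed

lemma sq_integrable_imp_integrable:
  assumes f: "sq_integrable f"
  shows "integrable torus f"
proof (rule Bochner_Integration.integrable_bound)
  show "integrable torus (\<lambda>z. 1 + (cmod (f z))\<^sup>2)"
    using f by (simp add: sq_integrable_def)
  have "cmod w \<le> 1 + (cmod w)\<^sup>2" for w
    using sum_squares_bound[of 1 "cmod w"] norm_ge_zero[of w] unfolding one_power2 by linarith
  then show "AE z in torus. norm (f z) \<le> norm (1 + (cmod (f z))\<^sup>2)"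
    by auto
qed (use f in \<open>simp add: sq_integrable_def\<close>)

quotient_type torus_l2 = "real \<times> real \<Rightarrow> complex" /
  partial: "\<lambda>f g. sq_integrable f \<and> sq_integrable g \<and> (AE z in torus. f z = g z)"
proof (rule part_equivpI)
  show "\<exists>f. sq_integrable f \<and> sq_integrable f \<and> (AE z in torus. f z = f z)"
    using sq_integrable_zero by auto
qed (auto intro!: sympI transpI elim: eventually_mono eventually_elim2)

instantiation torus_l2 :: complex_normed_vector
begin

lift_definition zero_torus_l2 :: torus_l2 is "\<lambda>_. 0"
  by (simp add: sq_integrable_zero)

lift_definition plus_torus_l2 :: "torus_l2 \<Rightarrow> torus_l2 \<Rightarrow> torus_l2" is "\<lambda>f g z. f z + g z"
  by (auto intro: sq_integrable_add elim: eventually_elim2)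

lift_definition scaleC_torus_l2 :: "complex \<Rightarrow> torus_l2 \<Rightarrow> torus_l2" is "\<lambda>c f z. c * f z"
  by (auto intro: sq_integrable_cmult elim: eventually_mono)

definition uminus_torus_l2 :: "torus_l2 \<Rightarrow> torus_l2" where
  "- f = (-1) *\<^sub>C (f::torus_l2)"

definition minus_torus_l2 :: "torus_l2 \<Rightarrow> torus_l2 \<Rightarrow> torus_l2" where
  "f - g = f + - (g::torus_l2)"

definition scaleR_torus_l2 :: "real \<Rightarrow> torus_l2 \<Rightarrow> torus_l2" where
  "r *\<^sub>R f = of_real r *\<^sub>C (f::torus_l2)"

lift_definition norm_torus_l2 :: "torus_l2 \<Rightarrow> real" is
  "\<lambda>f. sqrt (\<integral>z. (cmod (f z))\<^sup>2 \<partial>torus)"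
proof -
  fix f g
  assume *: "sq_integrable f \<and> sq_integrable g \<and> (AE z in torus. f z = g z)"
  then have [measurable]: "f \<in> borel_measurable torus" "g \<in> borel_measurable torus"
    by (auto dest: sq_integrable_measurable)
  have "(\<integral>z. (cmod (f z))\<^sup>2 \<partial>torus) = (\<integral>z. (cmod (g z))\<^sup>2 \<partial>torus)"
    using * by (intro integral_cong_AE) auto
  then show "sqrt (\<integral>z. (cmod (f z))\<^sup>2 \<partial>torus) = sqrt (\<integral>z. (cmod (g z))\<^sup>2 \<partial>torus)"
    by simp
qed

definition dist_torus_l2 :: "torus_l2 \<Rightarrow> torus_l2 \<Rightarrow> real" where
  "dist f g = norm (f - (g::torus_l2))"

definition sgn_torus_l2 :: "torus_l2 \<Rightarrow> torus_l2" where
  "sgn f = inverse (norm f) *\<^sub>R (f::torus_l2)"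

definition uniformity_torus_l2 :: "(torus_l2 \<times> torus_l2) filter" where
  "uniformity_torus_l2 = (INF e\<in>{0<..}. principal {(f, g). dist f g < e})"

definition open_torus_l2 :: "torus_l2 set \<Rightarrow> bool" where
  "open_torus_l2 U = (\<forall>f\<in>U. \<forall>\<^sub>F (f', g) in uniformity. f' = f \<longrightarrow> g \<in> U)"

lemma l2_minkowski:
  assumes f: "sq_integrable f" and g: "sq_integrable g"
  shows "sqrt (\<integral>z. (cmod (f z + g z))\<^sup>2 \<partial>torus) \<le>
         sqrt (\<integral>z. (cmod (f z))\<^sup>2 \<partial>torus) + sqrt (\<integral>z. (cmod (g z))\<^sup>2 \<partial>torus)"
proof (rule field_le_epsilon)
  fix e :: real assume e: "e > 0"
  define p where "p = sqrt (\<integral>z. (cmod (f z))\<^sup>2 \<partial>torus)"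
  define q where "q = sqrt (\<integral>z. (cmod (g z))\<^sup>2 \<partial>torus)"
  define a where "a = p + e / 2"
  define b where "b = q + e / 2"
  have p: "p \<ge> 0" "p\<^sup>2 = (\<integral>z. (cmod (f z))\<^sup>2 \<partial>torus)" by (simp_all add: p_def)
  have q: "q \<ge> 0" "q\<^sup>2 = (\<integral>z. (cmod (g z))\<^sup>2 \<partial>torus)" by (simp_all add: q_def)
  have ab: "a > 0" "b > 0" "p \<le> a" "q \<le> b" using e p q by (auto simp: a_def b_def)
  have pt: "(cmod (u + v))\<^sup>2 \<le> (1 + b / a) * (cmod u)\<^sup>2 + (1 + a / b) * (cmod v)\<^sup>2" for u v
    using ab(1,2) by (rule sq_norm_add_le_weighted)
  have "(\<integral>z. (cmod (f z + g z))\<^sup>2 \<partial>torus)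
      \<le> (\<integral>z. (1 + b / a) * (cmod (f z))\<^sup>2 + (1 + a / b) * (cmod (g z))\<^sup>2 \<partial>torus)"
    using f g sq_integrable_add[OF f g] pt
    by (intro integral_mono) (auto simp: sq_integrable_def)
  also have "\<dots> = (1 + b / a) * p\<^sup>2 + (1 + a / b) * q\<^sup>2"
    using f g by (simp add: sq_integrable_def p q)
  also have "\<dots> \<le> (1 + b / a) * a\<^sup>2 + (1 + a / b) * b\<^sup>2"
    using ab p q by (intro add_mono mult_left_mono power_mono) auto
  also have "\<dots> = (a + b)\<^sup>2"
    using ab by (simp add: field_simps power2_eq_square)
  finally have "sqrt (\<integral>z. (cmod (f z + g z))\<^sup>2 \<partial>torus) \<le> a + b"
    using ab by (intro real_le_lsqrt) auto
  then show "sqrt (\<integral>z. (cmod (f z + g z))\<^sup>2 \<partial>torus) \<le>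
      sqrt (\<integral>z. (cmod (f z))\<^sup>2 \<partial>torus) + sqrt (\<integral>z. (cmod (g z))\<^sup>2 \<partial>torus) + e"
    by (simp add: a_def b_def p_def q_def)
qed

instance
proof
  fix f g h :: torus_l2 and c d :: complex and r s :: real
  show C1: "c *\<^sub>C (f + g) = c *\<^sub>C f + c *\<^sub>C g" for c and f g :: torus_l2
    by transfer (auto simp: distrib_left intro: sq_integrable_cmult sq_integrable_add)
  show C2: "(c + d) *\<^sub>C f = c *\<^sub>C f + d *\<^sub>C f" for c d and f :: torus_l2
    by transfer (auto simp: distrib_right intro: sq_integrable_cmult sq_integrable_add)
  show C3: "c *\<^sub>C d *\<^sub>C f = (c * d) *\<^sub>C f" for c d and f :: torus_l2
    by transfer (auto simp: mult.assoc intro: sq_integrable_cmult)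
  have C4: "1 *\<^sub>C f = f" for f :: torus_l2
    by transfer auto
  show "of_real r *\<^sub>C f = r *\<^sub>R f" by (simp add: scaleR_torus_l2_def)
  show "f + g + h = f + (g + h)"
    by transfer (auto simp: add.assoc intro: sq_integrable_add)
  show "f + g = g + f"
    by transfer (auto simp: add.commute intro: sq_integrable_add)
  show "0 + f = f" by transfer (auto simp: sq_integrable_zero)
  have "(0::complex) *\<^sub>C f = 0"
    by transfer (auto simp: sq_integrable_zero)
  then show "- f + f = 0"
    using C2[of "-1" 1 f] by (simp add: uminus_torus_l2_def C4)
  show "f - g = f + - g" by (simp add: minus_torus_l2_def)
  show "r *\<^sub>R (f + g) = r *\<^sub>R f + r *\<^sub>R g" by (simp add: scaleR_torus_l2_def C1)
  show "(r + s) *\<^sub>R f = r *\<^sub>R f + s *\<^sub>R f" by (simp add: scaleR_torus_l2_def C2)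
  show "r *\<^sub>R s *\<^sub>R f = (r * s) *\<^sub>R f" by (simp add: scaleR_torus_l2_def C3)
  show "1 *\<^sub>R f = f" by (simp add: scaleR_torus_l2_def C4)
  show N: "norm (c *\<^sub>C f) = cmod c * norm f" for c
    by transfer (simp add: norm_mult power_mult_distrib real_sqrt_mult)
  show "norm (r *\<^sub>R f) = \<bar>r\<bar> * norm f" by (simp add: scaleR_torus_l2_def N)
  show "norm (f + g) \<le> norm f + norm g"
    by transfer (auto intro: l2_minkowski)
  show "norm f = 0 \<longleftrightarrow> f = 0"
  proof (transfer, clarify)
    fix f assume f: "sq_integrable f"
    then have "(\<integral>z. (cmod (f z))\<^sup>2 \<partial>torus) = 0 \<longleftrightarrow> (AE z in torus. (cmod (f z))\<^sup>2 = 0)"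
      by (intro integral_nonneg_eq_0_iff_AE) (auto simp: sq_integrable_def)
    with f show "sqrt (\<integral>z. (cmod (f z))\<^sup>2 \<partial>torus) = 0 \<longleftrightarrow>
        sq_integrable f \<and> sq_integrable (\<lambda>_. 0) \<and> (AE z in torus. f z = 0)"
      by (simp add: sq_integrable_zero)
  qed
qed (simp_all add: dist_torus_l2_def sgn_torus_l2_def uniformity_torus_l2_def open_torus_l2_def)

end


definition fourier_char :: "int \<times> int \<Rightarrow> real \<times> real \<Rightarrow> complex" where
  "fourier_char k z = cis (of_int (fst k) * fst z + of_int (snd k) * snd z)"

lemma fourier_char_measurable [measurable]: "fourier_char k \<in> borel_measurable torus"
  unfolding fourier_char_def
  by (intro borel_measurable_torusI borel_measurable_continuous_onI) (intro continuous_intros)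

lemma norm_fourier_char [simp]: "cmod (fourier_char k z) = 1"
  by (simp add: fourier_char_def)

lemma fourier_char_mult: "fourier_char k z * fourier_char l z = fourier_char (k + l) z"
  by (simp add: fourier_char_def cis_mult algebra_simps)

lemma fourier_char_0 [simp]: "fourier_char 0 z = 1"
  by (simp add: fourier_char_def)

lemma integrable_mult_bounded:
  assumes f: "integrable torus f" and [measurable]: "g \<in> borel_measurable torus"
    and b: "\<And>z. z \<in> space torus \<Longrightarrow> cmod (g z) \<le> B"
  shows "integrable torus (\<lambda>z. f z * g z)"
proof (rule Bochner_Integration.integrable_bound)
  have [measurable]: "f \<in> borel_measurable torus" using f by simp
  show "integrable torus (\<lambda>z. B * cmod (f z))" using f by simp
  show "AE z in torus. norm (f z * g z) \<le> norm (B * cmod (f z))"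
  proof (rule AE_I2)
    fix z assume "z \<in> space torus"
    then have "cmod (g z) \<le> \<bar>B\<bar>" using b[of z] by linarith
    then have "cmod (g z) * cmod (f z) \<le> \<bar>B\<bar> * cmod (f z)" by (rule mult_right_mono) simp
    then show "norm (f z * g z) \<le> norm (B * cmod (f z))"
      by (simp add: norm_mult abs_mult mult.commute)
  qed
  show "(\<lambda>z. f z * g z) \<in> borel_measurable torus" by measurable
qed

text \<open>Uniqueness of Fourier coefficients. It is what makes the weighted \<open>\<ell>\<^sup>2\<close> expression for
  the \<open>H\<^sup>1\<close> norm definite.\<close>

context
  fixes f :: "real \<times> real \<Rightarrow> complex"
  assumes int_f: "integrable torus f"
    and fz: "\<And>k. (\<integral>z. f z * fourier_char k z \<partial>torus) = 0"
begin

private definition Z :: "(real \<times> real \<Rightarrow> complex) set" where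
  "Z = {g. integrable torus g \<and> (\<forall>k. (\<integral>z. g z * fourier_char k z \<partial>torus) = 0)}"

private definition E :: "real \<times> real \<Rightarrow> complex \<times> complex" where
  "E z = (cis (fst z), cis (snd z))"

private lemma Z_int: "g \<in> Z \<Longrightarrow> integrable torus (\<lambda>z. g z * fourier_char k z)"
  by (rule integrable_mult_bounded[where B = 1]) (auto simp: Z_def)

private lemma Z_char: "g \<in> Z \<Longrightarrow> (\<lambda>z. g z * fourier_char k z) \<in> Z"
  using Z_int[of g k] by (auto simp: Z_def mult.assoc fourier_char_mult simp del: split_paired_All)

private lemma Z_add: "g \<in> Z \<Longrightarrow> h \<in> Z \<Longrightarrow> (\<lambda>z. g z + h z) \<in> Z"
  using Z_int[of g] Z_int[of h] by (auto simp: Z_def distrib_right)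

private lemma Z_cmult: "g \<in> Z \<Longrightarrow> (\<lambda>z. c * g z) \<in> Z"
  using Z_int[of g] by (auto simp: Z_def mult.assoc)

private lemma Z_poly:
  "real_polynomial_function p \<Longrightarrow> g \<in> Z \<Longrightarrow> (\<lambda>z. g z * of_real (p (E z))) \<in> Z"
proof (induction p arbitrary: g rule: real_polynomial_function.induct)
  case (linear p)
  define a b c d where "a = p (1, 0)" and "b = p (\<i>, 0)" and "c = p (0, 1)" and "d = p (0, \<i>)"
  interpret p: bounded_linear p by fact
  have p: "p (E z) = cos (fst z) * a + sin (fst z) * b + (cos (snd z) * c + sin (snd z) * d)" for z
  proof -
    have "E z = (cos (fst z) *\<^sub>R (1, 0) + sin (fst z) *\<^sub>R (\<i>, 0))
        + (cos (snd z) *\<^sub>R (0, 1) + sin (snd z) *\<^sub>R (0, \<i>))"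
      by (auto simp: E_def complex_eq_iff)
    then show ?thesis by (simp only: p.add p.scaleR a_def b_def c_def d_def real_scaleR_def)
  qed
  have ch: "of_real (cos (fst z)) = (fourier_char (1, 0) z + fourier_char (-1, 0) z) / 2"
    "of_real (sin (fst z)) = (fourier_char (1, 0) z - fourier_char (-1, 0) z) / (2 * \<i>)"
    "of_real (cos (snd z)) = (fourier_char (0, 1) z + fourier_char (0, -1) z) / 2"
    "of_real (sin (snd z)) = (fourier_char (0, 1) z - fourier_char (0, -1) z) / (2 * \<i>)" for z
    by (simp_all add: fourier_char_def complex_eq_iff)
  have "(\<lambda>z. g z * of_real (p (E z))) =
    (\<lambda>z. ((of_real a / 2 + of_real b / (2 * \<i>)) * (g z * fourier_char (1, 0) z)
         + (of_real a / 2 - of_real b / (2 * \<i>)) * (g z * fourier_char (-1, 0) z))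
       + ((of_real c / 2 + of_real d / (2 * \<i>)) * (g z * fourier_char (0, 1) z)
         + (of_real c / 2 - of_real d / (2 * \<i>)) * (g z * fourier_char (0, -1) z)))"
    unfolding p of_real_add of_real_mult ch by (rule ext) (simp add: field_simps)
  also have "\<dots> \<in> Z"
    by (intro Z_add Z_cmult Z_char linear)
  finally show ?case .
next
  case (const c)
  then show ?case using Z_cmult[of g "of_real c"] by (simp add: mult.commute)
next
  case (add p q)
  then show ?case using Z_add[OF add.IH(1) add.IH(2)] by (simp add: distrib_left)
next
  case (mult p q)
  then show ?case using mult.IH(2)[OF mult.IH(1)] by (simp add: mult.assoc)
qed

private lemma E_cont: "continuous_on A E"
  unfolding E_def by (intro continuous_intros)

private lemma cont_meas:
  "continuous_on UNIV h \<Longrightarrow> (\<lambda>z. complex_of_real (h (E z))) \<in> borel_measurable torus"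
  for h :: "complex \<times> complex \<Rightarrow> real"
proof -
  assume h: "continuous_on UNIV h"
  have "continuous_on UNIV (h \<circ> E)"
    by (rule continuous_on_compose[OF E_cont]) (rule continuous_on_subset[OF h], simp)
  then show ?thesis
    by (intro borel_measurable_torusI borel_measurable_continuous_onI continuous_on_of_real)
      (simp add: o_def)
qed

private lemma integral_cont:
  fixes h :: "complex \<times> complex \<Rightarrow> real"
  assumes h: "continuous_on UNIV h"
  shows "(\<integral>z. f z * of_real (h (E z)) \<partial>torus) = 0"
proof -
  let ?K = "sphere 0 1 \<times> sphere (0::complex) 1 :: (complex \<times> complex) set"
  have EK: "E z \<in> ?K" for z by (auto simp: E_def)
  have K: "compact ?K" by (intro compact_Times compact_sphere)
  have hm: "(\<lambda>z. complex_of_real (h (E z))) \<in> borel_measurable torus"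
    using h by (rule cont_meas)
  have "bounded (h ` ?K)"
    by (intro compact_imp_bounded compact_continuous_image K continuous_on_subset[OF h]) simp
  then obtain B where B: "\<And>w. w \<in> ?K \<Longrightarrow> \<bar>h w\<bar> \<le> B"
    unfolding bounded_iff by fastforce
  have ih: "integrable torus (\<lambda>z. f z * of_real (h (E z)))"
    by (rule integrable_mult_bounded[OF int_f hm, of B]) (use B EK in simp)
  have "cmod (\<integral>z. f z * of_real (h (E z)) \<partial>torus) \<le> e * (\<integral>z. cmod (f z) \<partial>torus)" if e: "e > 0" for e
  proof -
    obtain p where p: "polynomial_function p" "\<And>w. w \<in> ?K \<Longrightarrow> norm (h w - p w) < e"
      using Stone_Weierstrass_polynomial_function[OF K continuous_on_subset[OF h subset_UNIV] e] by blast
    have "f \<in> Z" using int_f fz by (simp add: Z_def)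
    then have pZ: "(\<lambda>z. f z * of_real (p (E z))) \<in> Z"
      using p(1) by (intro Z_poly) (simp add: real_polynomial_function_eq)
    then have ip: "integrable torus (\<lambda>z. f z * of_real (p (E z)))"
      by (simp add: Z_def)
    have zp: "(\<integral>z. f z * of_real (p (E z)) \<partial>torus) = 0"
    proof -
      have "(\<integral>z. f z * of_real (p (E z)) * fourier_char 0 z \<partial>torus) = 0"
        using pZ unfolding Z_def by blast
      then show ?thesis by simp
    qed
    have "(\<integral>z. f z * of_real (h (E z)) \<partial>torus)
        = (\<integral>z. f z * of_real (h (E z)) - f z * of_real (p (E z)) \<partial>torus)"
      using ih ip zp by simp
    also have "cmod \<dots> \<le> (\<integral>z. cmod (f z * of_real (h (E z)) - f z * of_real (p (E z))) \<partial>torus)"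
      by (rule integral_norm_bound)
    also have "\<dots> \<le> (\<integral>z. e * cmod (f z) \<partial>torus)"
    proof (rule integral_mono)
      fix z
      have "cmod (f z * of_real (h (E z)) - f z * of_real (p (E z)))
          = cmod (f z) * \<bar>h (E z) - p (E z)\<bar>"
        by (metis norm_mult norm_of_real of_real_diff right_diff_distrib)
      also have "\<dots> \<le> cmod (f z) * e"
        using p(2)[OF EK[of z]] by (intro mult_left_mono) auto
      finally show "cmod (f z * of_real (h (E z)) - f z * of_real (p (E z))) \<le> e * cmod (f z)"
        by (simp add: mult.commute)
    qed (use ih ip int_f in simp_all)
    finally show ?thesis by simp
  qed note bnd = this
  have "cmod (\<integral>z. f z * of_real (h (E z)) \<partial>torus) \<le> 0 + e" if e: "e > 0" for e
  proof -
    define N where "N = (\<integral>z. cmod (f z) \<partial>torus)"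
    have N: "N \<ge> 0" by (simp add: N_def)
    have "cmod (\<integral>z. f z * of_real (h (E z)) \<partial>torus) \<le> e / (N + 1) * N"
    proof -
      have "e / (N + 1) > 0" using e N by simp
      from bnd[OF this] show ?thesis by (simp only: N_def)
    qed
    also have "\<dots> \<le> e" using e N by (simp add: field_simps)
    finally show ?thesis by simp
  qed
  then have "cmod (\<integral>z. f z * of_real (h (E z)) \<partial>torus) \<le> 0"
    by (rule field_le_epsilon)
  then show ?thesis by simp
qed

private lemma E_inj:
  assumes "E z = E w" "z \<in> space torus" "w \<in> box (0, 0) (2 * pi, 2 * pi)"
  shows "z = w"
proof -
  have *: "x = y" if "cis x = cis y" "0 \<le> x" "x \<le> 2 * pi" "0 < y" "y < 2 * pi" for x y
  proof -
    have "cos (x - y) = 1"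
      using arg_cong[OF that(1), of "\<lambda>u. Re (u * cnj (cis y))"]
      by (simp add: cos_diff power2_eq_square[symmetric])
    then obtain n :: int where n: "x - y = of_int n * 2 * pi" unfolding cos_one_2pi_int by blast
    have "\<bar>real_of_int n * (2 * pi)\<bar> < 1 * (2 * pi)" using that(2-) n by linarith
    then have "\<bar>real_of_int n\<bar> < 1" by (simp add: abs_mult)
    then have "n = 0" by linarith
    with n show ?thesis by simp
  qed
  show ?thesis
    using assms *[of "fst z" "fst w"] *[of "snd z" "snd w"]
    by (cases z; cases w) (auto simp: E_def space_torus mem_box_Pair)
qed

private lemma integral_compact:
  assumes C: "compact C" "C \<subseteq> box (0, 0) (2 * pi, 2 * pi)"
  shows "(\<integral>z. indicator C z *\<^sub>R f z \<partial>torus) = 0"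
proof (cases "C = {}")
  case False
  define h where "h n w = max 0 (1 - real n * infdist w (E ` C))" for n w
  have EC: "closed (E ` C)"
    by (intro compact_imp_closed compact_continuous_image E_cont C)
  have "(\<lambda>n. \<integral>z. f z * of_real (h n (E z)) \<partial>torus) \<longlonglongrightarrow> (\<integral>z. indicator C z *\<^sub>R f z \<partial>torus)"
  proof (rule integral_dominated_convergence[where w = "\<lambda>z. cmod (f z)"])
    show "integrable torus (\<lambda>z. cmod (f z))" using int_f by simp
    show "(\<lambda>z. indicator C z *\<^sub>R f z) \<in> borel_measurable torus"
      using C(1) by (intro borel_measurable_scaleR borel_measurable_integrable[OF int_f] borel_measurable_torusI)
        (auto simp: borel_compact intro!: borel_measurable_indicator)
    show "(\<lambda>z. f z * of_real (h n (E z))) \<in> borel_measurable torus" for n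
      using int_f unfolding h_def
      by (intro borel_measurable_times cont_meas continuous_intros) auto
    show "AE z in torus. norm (f z * of_real (h n (E z))) \<le> cmod (f z)" for n
    proof (rule AE_I2)
      fix z
      have "\<bar>h n (E z)\<bar> \<le> 1" using infdist_nonneg[of "E z" "E ` C"] by (auto simp: h_def)
      then show "norm (f z * of_real (h n (E z))) \<le> cmod (f z)"
        using mult_left_mono[of "\<bar>h n (E z)\<bar>" 1 "cmod (f z)"] by (simp add: norm_mult)
    qed
    show "AE z in torus. (\<lambda>n. f z * of_real (h n (E z))) \<longlonglongrightarrow> indicator C z *\<^sub>R f z"
    proof (rule AE_I2)
      fix z assume z: "z \<in> space torus"
      show "(\<lambda>n. f z * of_real (h n (E z))) \<longlonglongrightarrow> indicator C z *\<^sub>R f z"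
      proof (cases "z \<in> C")
        case True
        then show ?thesis by (simp add: h_def)
      next
        case zC: False
        then have "E z \<notin> E ` C" using E_inj[OF _ z] C(2) by blast
        then have d: "infdist (E z) (E ` C) > 0"
          using EC False infdist_nonneg[of "E z" "E ` C"]
          by (metis image_is_empty in_closed_iff_infdist_zero less_eq_real_def)
        obtain N where N: "1 < real N * infdist (E z) (E ` C)"
          using reals_Archimedean3[OF d] by blast
        have "h n (E z) = 0" if "n \<ge> N" for n
        proof -
          have "real N * infdist (E z) (E ` C) \<le> real n * infdist (E z) (E ` C)"
            using d that by (intro mult_right_mono) auto
          with N show ?thesis by (simp add: h_def)
        qed
        then have "\<forall>\<^sub>F n in sequentially. f z * of_real (h n (E z)) = indicator C z *\<^sub>R f z"
          using zC by (intro eventually_sequentiallyI[of N]) simp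
        then show ?thesis by (rule tendsto_eventually)
      qed
    qed
  qed
  moreover have "(\<integral>z. f z * of_real (h n (E z)) \<partial>torus) = 0" for n
    by (rule integral_cont) (auto simp: h_def intro!: continuous_intros)
  ultimately show ?thesis by (simp add: LIMSEQ_const_iff)
qed simp

private lemma integral_box_Int:
  assumes C: "A \<in> sets borel"
  shows "(\<integral>z. indicator (A \<inter> box (0, 0) (2 * pi, 2 * pi)) z *\<^sub>R f z \<partial>torus) = 0"
proof -
  let ?U = "box (0, 0) (2 * pi, 2 * pi) :: (real \<times> real) set"
  define P where "P A \<longleftrightarrow> (\<integral>z. indicator (A \<inter> ?U) z *\<^sub>R f z \<partial>torus) = 0" for A
  have sets_torus: "space torus \<inter> A \<in> sets torus" if "A \<in> sets borel" for A
    using that by (auto simp: torus_def sets_restrict_space space_restrict_space)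
  have int: "integrable torus (\<lambda>z. indicator A z *\<^sub>R f z)" if "A \<in> sets borel" for A
  proof -
    have "integrable torus (\<lambda>z. indicator (space torus \<inter> A) z *\<^sub>R f z)"
      by (rule integrable_mult_indicator[OF sets_torus[OF that] int_f])
    then show ?thesis
      by (rule Bochner_Integration.integrable_cong[THEN iffD1, rotated -1])
        (auto simp: indicator_def)
  qed
  have closed: "P A" if "closed A" for A
  proof -
    define K where "K n = cbox (1 / real (Suc n), 1 / real (Suc n))
       (2 * pi - 1 / real (Suc n), 2 * pi - 1 / real (Suc n))" for n
    have KU: "K n \<subseteq> ?U" for n
    proof
      fix z assume z: "z \<in> K n"
      obtain x y where xy: "z = (x, y)" by fastforce
      have "1 / real (Suc n) > 0" by simp
      moreover have "1 / real (Suc n) \<le> x" "x \<le> 2 * pi - 1 / real (Suc n)"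
        "1 / real (Suc n) \<le> y" "y \<le> 2 * pi - 1 / real (Suc n)"
        using z unfolding xy K_def mem_cbox_Pair by blast+
      ultimately show "z \<in> ?U"
        unfolding xy mem_box_Pair by linarith
    qed
    have z: "(\<integral>z. indicator (A \<inter> K n) z *\<^sub>R f z \<partial>torus) = 0" for n
      by (rule integral_compact)
        (use KU that in \<open>auto simp: K_def intro!: closed_Int_compact\<close>)
    have "(\<lambda>n. \<integral>z. indicator (A \<inter> K n) z *\<^sub>R f z \<partial>torus)
        \<longlonglongrightarrow> (\<integral>z. indicator (A \<inter> ?U) z *\<^sub>R f z \<partial>torus)"
    proof (rule integral_dominated_convergence[where w = "\<lambda>z. cmod (f z)"])
      show "integrable torus (\<lambda>z. cmod (f z))" using int_f by simp
      show "(\<lambda>z. indicator (A \<inter> ?U) z *\<^sub>R f z) \<in> borel_measurable torus"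
        using that by (intro borel_measurable_integrable int) auto
      show "(\<lambda>z. indicator (A \<inter> K n) z *\<^sub>R f z) \<in> borel_measurable torus" for n
        using that by (intro borel_measurable_integrable int) (auto simp: K_def)
      show "AE z in torus. norm (indicator (A \<inter> K n) z *\<^sub>R f z) \<le> cmod (f z)" for n
        by (auto simp: indicator_def)
      show "AE z in torus. (\<lambda>n. indicator (A \<inter> K n) z *\<^sub>R f z) \<longlonglongrightarrow> indicator (A \<inter> ?U) z *\<^sub>R f z"
      proof (rule AE_I2)
        fix z :: "real \<times> real"
        show "(\<lambda>n. indicator (A \<inter> K n) z *\<^sub>R f z) \<longlonglongrightarrow> indicator (A \<inter> ?U) z *\<^sub>R f z"
        proof (cases "z \<in> ?U")
          case True
          define m where "m = Min {fst z, snd z, 2 * pi - fst z, 2 * pi - snd z}"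
          have "m > 0" using True by (cases z) (auto simp: m_def mem_box_Pair)
          then obtain N where N: "1 / real (Suc N) < m" using nat_approx_posE by blast
          have "z \<in> K n" if "n \<ge> N" for n
          proof -
            have "1 / real (Suc n) \<le> 1 / real (Suc N)" using that by (simp add: frac_le)
            with N have "1 / real (Suc n) < m" by linarith
            then show ?thesis by (cases z) (auto simp: K_def cbox_Pair_eq m_def)
          qed
          then have "\<forall>\<^sub>F n in sequentially.
              indicator (A \<inter> K n) z *\<^sub>R f z = indicator (A \<inter> ?U) z *\<^sub>R f z"
            using True by (intro eventually_sequentiallyI[of N]) (auto simp: indicator_def)
          then show ?thesis by (rule tendsto_eventually)
        next
          case False
          then have "z \<notin> K n" for n using KU by blast
          with False show ?thesis by simp
        qed
      qed
    qed
    with z show ?thesis by (simp add: LIMSEQ_const_iff P_def)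
  qed
  have "Int_stable (Collect closed :: (real \<times> real) set set)"
    by (auto simp: Int_stable_def)
  moreover have "Collect closed \<subseteq> Pow (UNIV :: (real \<times> real) set)" by simp
  moreover have "A \<in> sigma_sets UNIV (Collect closed)"
    using C by (simp add: borel_eq_closed)
  ultimately have "P A"
  proof (induction rule: sigma_sets_induct_disjoint)
    case (basic A)
    then show ?case using closed by simp
  next
    case empty
    then show ?case by (simp add: P_def)
  next
    case (compl A)
    have A: "A \<in> sets borel" using compl by (simp add: borel_eq_closed)
    have "(\<integral>z. indicator ((UNIV - A) \<inter> ?U) z *\<^sub>R f z \<partial>torus)
       = (\<integral>z. indicator (UNIV \<inter> ?U) z *\<^sub>R f z - indicator (A \<inter> ?U) z *\<^sub>R f z \<partial>torus)"
      by (intro Bochner_Integration.integral_cong) (auto simp: indicator_def)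
    also have "\<dots> = (\<integral>z. indicator (UNIV \<inter> ?U) z *\<^sub>R f z \<partial>torus)
         - (\<integral>z. indicator (A \<inter> ?U) z *\<^sub>R f z \<partial>torus)"
      using A by (intro Bochner_Integration.integral_diff int) auto
    also have "\<dots> = 0" using compl closed[of UNIV] by (simp add: P_def)
    finally show ?case by (simp add: P_def)
  next
    case (union A)
    have A: "A i \<in> sets borel" for i using union by (auto simp: borel_eq_closed)
    have P: "(\<integral>z. indicator (A i \<inter> ?U) z *\<^sub>R f z \<partial>torus) = 0" for i
      using union(3)[of i] by (simp add: P_def)
    define B where "B n = (\<Union>i<n. A i)" for n :: nat
    have B: "B n \<in> sets borel" for n using A by (auto simp: B_def)
    have PB: "P (B n)" for n
    proof (induction n)
      case (Suc n)
      have "A n \<inter> A i = {}" if "i < n" for i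
        using union(1) that unfolding disjoint_family_on_def by (metis UNIV_I less_irrefl)
      then have "A n \<inter> B n = {}" unfolding B_def by blast
      then have "(\<integral>z. indicator (B (Suc n) \<inter> ?U) z *\<^sub>R f z \<partial>torus)
       = (\<integral>z. indicator (B n \<inter> ?U) z *\<^sub>R f z + indicator (A n \<inter> ?U) z *\<^sub>R f z \<partial>torus)"
        by (intro Bochner_Integration.integral_cong)
          (auto simp: indicator_def B_def lessThan_Suc)
      also have "\<dots> = (\<integral>z. indicator (B n \<inter> ?U) z *\<^sub>R f z \<partial>torus)
         + (\<integral>z. indicator (A n \<inter> ?U) z *\<^sub>R f z \<partial>torus)"
        using A B by (intro Bochner_Integration.integral_add int) auto
      finally show ?case using Suc P by (simp add: P_def)
    qed (simp add: P_def B_def)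
    have "(\<lambda>n. \<integral>z. indicator (B n \<inter> ?U) z *\<^sub>R f z \<partial>torus)
        \<longlonglongrightarrow> (\<integral>z. indicator ((\<Union>i. A i) \<inter> ?U) z *\<^sub>R f z \<partial>torus)"
    proof (rule integral_dominated_convergence[where w = "\<lambda>z. cmod (f z)"])
      show "integrable torus (\<lambda>z. cmod (f z))" using int_f by simp
      show "(\<lambda>z. indicator ((\<Union>i. A i) \<inter> ?U) z *\<^sub>R f z) \<in> borel_measurable torus"
        using A by (intro borel_measurable_integrable int) auto
      show "(\<lambda>z. indicator (B n \<inter> ?U) z *\<^sub>R f z) \<in> borel_measurable torus" for n
        using B by (intro borel_measurable_integrable int) auto
      show "AE z in torus. norm (indicator (B n \<inter> ?U) z *\<^sub>R f z) \<le> cmod (f z)" for n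
        by (auto simp: indicator_def)
      show "AE z in torus. (\<lambda>n. indicator (B n \<inter> ?U) z *\<^sub>R f z)
          \<longlonglongrightarrow> indicator ((\<Union>i. A i) \<inter> ?U) z *\<^sub>R f z"
      proof (rule AE_I2)
        fix z :: "real \<times> real"
        show "(\<lambda>n. indicator (B n \<inter> ?U) z *\<^sub>R f z) \<longlonglongrightarrow> indicator ((\<Union>i. A i) \<inter> ?U) z *\<^sub>R f z"
        proof (cases "z \<in> (\<Union>i. A i)")
          case True
          then obtain i where i: "z \<in> A i" by blast
          have "\<forall>\<^sub>F n in sequentially.
              indicator (B n \<inter> ?U) z *\<^sub>R f z = indicator ((\<Union>i. A i) \<inter> ?U) z *\<^sub>R f z"
            using i by (intro eventually_sequentiallyI[of "Suc i"])
              (auto simp: indicator_def B_def)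
          then show ?thesis by (rule tendsto_eventually)
        next
          case False
          then have "z \<notin> B n" for n by (auto simp: B_def)
          with False show ?thesis by simp
        qed
      qed
    qed
    with PB show ?case by (simp add: LIMSEQ_const_iff P_def)
  qed
  then show ?thesis by (simp add: P_def)
qed

lemma fourier_unique_aux: "AE z in torus. f z = 0"
proof -
  let ?U = "box (0, 0) (2 * pi, 2 * pi) :: (real \<times> real) set"
  let ?g = "\<lambda>z. indicator ?U z *\<^sub>R f z"
  have U: "space torus \<inter> ?U \<in> sets torus"
    by (auto simp: torus_def sets_restrict_space space_restrict_space)
  have "integrable torus (\<lambda>z. indicator (space torus \<inter> ?U) z *\<^sub>R f z)"
    by (rule integrable_mult_indicator[OF U int_f])
  then have "integrable torus ?g"
    by (rule Bochner_Integration.integrable_cong[THEN iffD1, rotated -1])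
      (auto simp: indicator_def)
  then have "AE z in torus. ?g z = 0"
  proof (rule torus.density_zero)
    fix A assume "A \<in> sets torus"
    then have A: "A \<in> sets borel"
      by (auto simp: torus_def torus_square sets_restrict_space)
    have "set_lebesgue_integral torus A ?g = (\<integral>z. indicator (A \<inter> ?U) z *\<^sub>R f z \<partial>torus)"
      unfolding set_lebesgue_integral_def
      by (intro Bochner_Integration.integral_cong) (auto simp: indicator_def)
    then show "set_lebesgue_integral torus A ?g = 0"
      using integral_box_Int[OF A] by simp
  qed
  moreover have "AE z in torus. z \<in> ?U"
  proof (rule AE_I')
    let ?N = "cbox (0, 0) (2 * pi, 2 * pi) - ?U"
    have "emeasure lborel ?N = emeasure lborel (cbox (0, 0) (2 * pi, 2 * pi) :: (real \<times> real) set)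
        - emeasure lborel ?U"
      by (intro emeasure_Diff) (auto simp: emeasure_lborel_box_eq box_subset_cbox)
    also have "\<dots> = 0"
      by (simp add: emeasure_lborel_box_eq emeasure_lborel_cbox_eq)
    finally have "emeasure lborel ?N = 0" .
    then have "emeasure torus ?N = 0"
      unfolding torus_def torus_square by (subst emeasure_restrict_space) auto
    moreover have "?N \<in> sets torus"
      by (auto simp: torus_def torus_square sets_restrict_space intro!: image_eqI[of _ _ "- ?U"])
    ultimately show "?N \<in> null_sets torus" by auto
    show "{z \<in> space torus. z \<notin> ?U} \<subseteq> ?N"
      by (auto simp: space_torus torus_square)
  qed
  ultimately show ?thesis by eventually_elim simp
qed

end


lift_definition fourier :: "torus_l2 \<Rightarrow> int \<times> int \<Rightarrow> complex" is
  "\<lambda>f k. (\<integral>z. fourier_char (- k) z * f z \<partial>torus) / (2 * pi)"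
proof (rule ext)
  fix f g :: "real \<times> real \<Rightarrow> complex" and k
  assume *: "sq_integrable f \<and> sq_integrable g \<and> (AE z in torus. f z = g z)"
  then have [measurable]: "f \<in> borel_measurable torus" "g \<in> borel_measurable torus"
    by (auto dest: sq_integrable_measurable)
  have "(\<integral>z. fourier_char (- k) z * f z \<partial>torus) = (\<integral>z. fourier_char (- k) z * g z \<partial>torus)"
    using * by (intro integral_cong_AE) auto
  then show "(\<integral>z. fourier_char (- k) z * f z \<partial>torus) / (2 * pi)
      = (\<integral>z. fourier_char (- k) z * g z \<partial>torus) / (2 * pi)" by simp
qed

lemma integrable_fourier_char_mult:
  "sq_integrable f \<Longrightarrow> integrable torus (\<lambda>z. fourier_char k z * f z)"
  by (intro sq_integrable_imp_integrable sq_integrable_bounded_mult[where B = 1]) auto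

lemma fourier_add: "fourier (u + v) k = fourier u k + fourier v k"
  by transfer
    (auto simp: distrib_left add_divide_distrib integrable_fourier_char_mult)

lemma fourier_scaleC: "fourier (c *\<^sub>C u) k = c * fourier u k"
  by transfer (simp add: mult.left_commute)

lemma fourier_zero [simp]: "fourier 0 k = 0"
  by transfer simp

lemma fourier_unique:
  assumes f: "sq_integrable f"
    and z: "\<And>k. (\<integral>z. fourier_char (- k) z * f z \<partial>torus) / (2 * pi) = 0"
  shows "AE z in torus. f z = 0"
proof (rule fourier_unique_aux)
  show "integrable torus f" using f by (rule sq_integrable_imp_integrable)
  show "(\<integral>z. f z * fourier_char k z \<partial>torus) = 0" for k
    using z[of "- k"] by (simp add: mult.commute)
qed

lemma fourier_eq_0_imp: "(\<And>k. fourier u k = 0) \<Longrightarrow> u = 0"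
  by transfer (use fourier_unique sq_integrable_zero in blast)

definition sobolev_term :: "real \<Rightarrow> torus_l2 \<Rightarrow> int \<times> int \<Rightarrow> real" where
  "sobolev_term s u k =
     (if k = 0 then 1 else norm (real_of_int (fst k), real_of_int (snd k)) powr (2 * s))
       * (cmod (fourier u k))\<^sup>2"

text \<open>Adequate for \<open>s \<ge> 0\<close> only, where \<open>H\<^sup>s\<close> consists of \<open>L\<^sup>2\<close> functions.\<close>

definition sobolev :: "real \<Rightarrow> torus_l2 set" where
  "sobolev s = {u. sobolev_term s u summable_on UNIV}"

definition sobolev_norm :: "real \<Rightarrow> torus_l2 \<Rightarrow> real" where
  "sobolev_norm s u = sqrt (\<Sum>\<^sub>\<infinity>k. sobolev_term s u k)"

lemma sobolev_term_nonneg: "sobolev_term s u k \<ge> 0"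
  by (simp add: sobolev_term_def)

lemma sobolev_term_add_le:
  assumes "a > 0" "b > 0"
  shows "sobolev_term s (u + v) k \<le> (1 + b / a) * sobolev_term s u k + (1 + a / b) * sobolev_term s v k"
proof -
  define w where
    "w = (if k = 0 then 1 else norm (real_of_int (fst k), real_of_int (snd k)) powr (2 * s))"
  have "w \<ge> 0" by (simp add: w_def)
  then have "w * (cmod (fourier u k + fourier v k))\<^sup>2
      \<le> w * ((1 + b / a) * (cmod (fourier u k))\<^sup>2 + (1 + a / b) * (cmod (fourier v k))\<^sup>2)"
    by (intro mult_left_mono sq_norm_add_le_weighted assms)
  then show ?thesis
    unfolding sobolev_term_def w_def[symmetric] fourier_add by (simp add: algebra_simps)
qed

lemma sobolev_zero: "0 \<in> sobolev s"
proof -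
  have "sobolev_term s 0 = (\<lambda>_. 0)" by (simp add: fun_eq_iff sobolev_term_def)
  then show ?thesis by (simp add: sobolev_def)
qed

lemma sobolev_add:
  assumes "u \<in> sobolev s" "v \<in> sobolev s"
  shows "u + v \<in> sobolev s"
proof -
  have "(\<lambda>k. (1 + 1 / 1) * sobolev_term s u k + (1 + 1 / 1) * sobolev_term s v k) summable_on UNIV"
    using assms by (intro summable_on_add summable_on_cmult_right) (auto simp: sobolev_def)
  then have "sobolev_term s (u + v) summable_on UNIV"
    by (rule summable_on_comparison_test)
      (use sobolev_term_add_le[of 1 1] sobolev_term_nonneg in auto)
  then show ?thesis by (simp add: sobolev_def)
qed

lemma sobolev_term_scaleC: "sobolev_term s (c *\<^sub>C u) k = (cmod c)\<^sup>2 * sobolev_term s u k"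
  by (simp add: sobolev_term_def fourier_scaleC norm_mult power_mult_distrib)

lemma sobolev_scaleC: "u \<in> sobolev s \<Longrightarrow> c *\<^sub>C u \<in> sobolev s"
  unfolding sobolev_def mem_Collect_eq sobolev_term_scaleC[abs_def]
  by (rule summable_on_cmult_right)

lemma sobolev_norm_scaleC: "sobolev_norm s (c *\<^sub>C u) = cmod c * sobolev_norm s u"
  by (simp add: sobolev_norm_def sobolev_term_scaleC infsum_cmult_right' real_sqrt_mult)

lemma sobolev_norm_eq_0_iff:
  assumes u: "u \<in> sobolev s"
  shows "sobolev_norm s u = 0 \<longleftrightarrow> u = 0"
proof
  assume "sobolev_norm s u = 0"
  then have z: "(\<Sum>\<^sub>\<infinity>k. sobolev_term s u k) = 0" by (simp add: sobolev_norm_def)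
  have t: "sobolev_term s u k = 0" for k
    by (rule nonneg_infsum_le_0D[where A = UNIV and f = "sobolev_term s u"])
      (use z u sobolev_term_nonneg in \<open>auto simp: sobolev_def\<close>)
  have n: "norm (real_of_int (fst k), real_of_int (snd k)) \<noteq> 0" if "k \<noteq> 0" for k
    using that by (auto simp: prod_eq_iff)
  have "fourier u k = 0" for k
    using t[of k] n[of k] by (cases "k = 0") (simp_all add: sobolev_term_def)
  then show "u = 0" by (rule fourier_eq_0_imp)
qed (simp add: sobolev_norm_def sobolev_term_def)

lemma sobolev_norm_triangle:
  assumes u: "u \<in> sobolev s" and v: "v \<in> sobolev s"
  shows "sobolev_norm s (u + v) \<le> sobolev_norm s u + sobolev_norm s v"
proof (rule field_le_epsilon)
  fix e :: real assume e: "e > 0"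
  define p where "p = sobolev_norm s u"
  define q where "q = sobolev_norm s v"
  define a where "a = p + e / 2"
  define b where "b = q + e / 2"
  have nn: "(\<Sum>\<^sub>\<infinity>k. sobolev_term s w k) \<ge> 0" for w
    by (intro infsum_nonneg sobolev_term_nonneg)
  have p: "p \<ge> 0" "p\<^sup>2 = (\<Sum>\<^sub>\<infinity>k. sobolev_term s u k)"
    using nn by (simp_all add: p_def sobolev_norm_def)
  have q: "q \<ge> 0" "q\<^sup>2 = (\<Sum>\<^sub>\<infinity>k. sobolev_term s v k)"
    using nn by (simp_all add: q_def sobolev_norm_def)
  have ab: "a > 0" "b > 0" "p \<le> a" "q \<le> b" using e p q by (auto simp: a_def b_def)
  have su: "(\<lambda>k. (1 + b / a) * sobolev_term s u k) summable_on UNIV"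
    and sv: "(\<lambda>k. (1 + a / b) * sobolev_term s v k) summable_on UNIV"
    using u v by (auto simp: sobolev_def intro: summable_on_cmult_right)
  have "(\<Sum>\<^sub>\<infinity>k. sobolev_term s (u + v) k)
      \<le> (\<Sum>\<^sub>\<infinity>k. (1 + b / a) * sobolev_term s u k + (1 + a / b) * sobolev_term s v k)"
    using sobolev_add[OF u v] su sv ab
    by (intro infsum_mono summable_on_add sobolev_term_add_le) (auto simp: sobolev_def)
  also have "\<dots> = (1 + b / a) * p\<^sup>2 + (1 + a / b) * q\<^sup>2"
    by (simp add: infsum_add[OF su sv] p q infsum_cmult_right')
  also have "\<dots> \<le> (1 + b / a) * a\<^sup>2 + (1 + a / b) * b\<^sup>2"
    using ab p q by (intro add_mono mult_left_mono power_mono) auto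
  also have "\<dots> = (a + b)\<^sup>2"
    using ab by (simp add: field_simps power2_eq_square)
  finally have "sobolev_norm s (u + v) \<le> a + b"
    unfolding sobolev_norm_def using ab by (intro real_le_lsqrt) auto
  then show "sobolev_norm s (u + v) \<le> sobolev_norm s u + sobolev_norm s v + e"
    by (simp add: a_def b_def p_def q_def)
qed

typedef torus_h1 = "sobolev 1"
  morphisms l2_of_h1 Abs_torus_h1
  using sobolev_zero by blast

setup_lifting type_definition_torus_h1

instantiation torus_h1 :: complex_normed_vector
begin

lift_definition zero_torus_h1 :: torus_h1 is 0
  by (rule sobolev_zero)

lift_definition plus_torus_h1 :: "torus_h1 \<Rightarrow> torus_h1 \<Rightarrow> torus_h1" is "(+)"
  by (rule sobolev_add)

lift_definition scaleC_torus_h1 :: "complex \<Rightarrow> torus_h1 \<Rightarrow> torus_h1" is scaleC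
  by (rule sobolev_scaleC)

definition uminus_torus_h1 :: "torus_h1 \<Rightarrow> torus_h1" where
  "- u = (-1) *\<^sub>C (u::torus_h1)"

definition minus_torus_h1 :: "torus_h1 \<Rightarrow> torus_h1 \<Rightarrow> torus_h1" where
  "u - v = u + - (v::torus_h1)"

definition scaleR_torus_h1 :: "real \<Rightarrow> torus_h1 \<Rightarrow> torus_h1" where
  "r *\<^sub>R u = of_real r *\<^sub>C (u::torus_h1)"

lift_definition norm_torus_h1 :: "torus_h1 \<Rightarrow> real" is "sobolev_norm 1" .

definition dist_torus_h1 :: "torus_h1 \<Rightarrow> torus_h1 \<Rightarrow> real" where
  "dist u v = norm (u - (v::torus_h1))"

definition sgn_torus_h1 :: "torus_h1 \<Rightarrow> torus_h1" where
  "sgn u = inverse (norm u) *\<^sub>R (u::torus_h1)"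

definition uniformity_torus_h1 :: "(torus_h1 \<times> torus_h1) filter" where
  "uniformity_torus_h1 = (INF e\<in>{0<..}. principal {(u, v). dist u v < e})"

definition open_torus_h1 :: "torus_h1 set \<Rightarrow> bool" where
  "open_torus_h1 U = (\<forall>u\<in>U. \<forall>\<^sub>F (u', v) in uniformity. u' = u \<longrightarrow> v \<in> U)"

instance
proof
  fix f g h :: torus_h1 and c d :: complex and r s :: real
  show C1: "c *\<^sub>C (f + g) = c *\<^sub>C f + c *\<^sub>C g" for c and f g :: torus_h1
    by transfer (rule scaleC_add_right)
  show C2: "(c + d) *\<^sub>C f = c *\<^sub>C f + d *\<^sub>C f" for c d and f :: torus_h1
    by transfer (rule scaleC_add_left)
  show C3: "c *\<^sub>C d *\<^sub>C f = (c * d) *\<^sub>C f" for c d and f :: torus_h1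
    by transfer (rule scaleC_scaleC)
  have C4: "1 *\<^sub>C f = f" for f :: torus_h1
    by transfer (use scaleC_of_real[of 1] in simp)
  show "of_real r *\<^sub>C f = r *\<^sub>R f" by (simp add: scaleR_torus_h1_def)
  show "f + g + h = f + (g + h)" by transfer (rule add.assoc)
  show "f + g = g + f" by transfer (rule add.commute)
  show "0 + f = f" by transfer simp
  have "(0::complex) *\<^sub>C f = 0"
    by transfer (use scaleC_of_real[of 0] in simp)
  then show "- f + f = 0"
    using C2[of "-1" 1 f] by (simp add: uminus_torus_h1_def C4)
  show "f - g = f + - g" by (simp add: minus_torus_h1_def)
  show "r *\<^sub>R (f + g) = r *\<^sub>R f + r *\<^sub>R g" by (simp add: scaleR_torus_h1_def C1)
  show "(r + s) *\<^sub>R f = r *\<^sub>R f + s *\<^sub>R f" by (simp add: scaleR_torus_h1_def C2)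
  show "r *\<^sub>R s *\<^sub>R f = (r * s) *\<^sub>R f" by (simp add: scaleR_torus_h1_def C3)
  show "1 *\<^sub>R f = f" by (simp add: scaleR_torus_h1_def C4)
  show N: "norm (c *\<^sub>C f) = cmod c * norm f" for c
    by transfer (rule sobolev_norm_scaleC)
  show "norm (r *\<^sub>R f) = \<bar>r\<bar> * norm f" by (simp add: scaleR_torus_h1_def N)
  show "norm (f + g) \<le> norm f + norm g"
    by transfer (rule sobolev_norm_triangle)
  show "norm f = 0 \<longleftrightarrow> f = 0"
    by transfer (rule sobolev_norm_eq_0_iff)
qed (simp_all add: dist_torus_h1_def sgn_torus_h1_def uniformity_torus_h1_def open_torus_h1_def)

end


definition pdx :: "(real \<times> real \<Rightarrow> complex) \<Rightarrow> real \<times> real \<Rightarrow> complex" where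
  "pdx \<phi> = (\<lambda>(x, y). vector_derivative (\<lambda>s. \<phi> (s, y)) (at x))"

definition pdy :: "(real \<times> real \<Rightarrow> complex) \<Rightarrow> real \<times> real \<Rightarrow> complex" where
  "pdy \<phi> = (\<lambda>(x, y). vector_derivative (\<lambda>s. \<phi> (x, s)) (at y))"

text \<open>The \<open>C\<^sup>\<infinity>\<close> functions on the torus, as the largest class of continuous periodic functions
  that have both partial derivatives and is closed under taking them.\<close>

coinductive smooth_periodic :: "(real \<times> real \<Rightarrow> complex) \<Rightarrow> bool" where
  "\<lbrakk>continuous_on UNIV \<phi>;
    \<And>x y. \<phi> (x + 2 * pi, y) = \<phi> (x, y) \<and> \<phi> (x, y + 2 * pi) = \<phi> (x, y);
    \<And>x y. (\<lambda>s. \<phi> (s, y)) differentiable (at x) \<and> (\<lambda>s. \<phi> (x, s)) differentiable (at y);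
    smooth_periodic (pdx \<phi>); smooth_periodic (pdy \<phi>)\<rbrakk> \<Longrightarrow> smooth_periodic \<phi>"

lemma smooth_periodic_pdx: "smooth_periodic \<phi> \<Longrightarrow> smooth_periodic (pdx \<phi>)"
  by (erule smooth_periodic.cases) simp

lemma smooth_periodic_pdy: "smooth_periodic \<phi> \<Longrightarrow> smooth_periodic (pdy \<phi>)"
  by (erule smooth_periodic.cases) simp

lemma smooth_periodic_measurable: "smooth_periodic \<phi> \<Longrightarrow> \<phi> \<in> borel_measurable torus"
  by (erule smooth_periodic.cases)
    (auto intro: borel_measurable_torusI borel_measurable_continuous_onI)

lemma l2_pairing_cong:
  assumes "sq_integrable f \<and> sq_integrable g \<and> (AE z in torus. f z = g z)"
    and [measurable]: "\<phi> \<in> borel_measurable torus"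
  shows "(\<integral>z. f z * \<phi> z \<partial>torus) = (\<integral>z. g z * \<phi> z \<partial>torus)"
proof -
  have [measurable]: "f \<in> borel_measurable torus" "g \<in> borel_measurable torus"
    using assms(1) by (auto dest: sq_integrable_measurable)
  show ?thesis
    using assms(1) by (intro integral_cong_AE) auto
qed

text \<open>\<open>weak_dx u g\<close> and \<open>weak_laplacian u w\<close> say that \<open>g = \<partial>\<^sub>x u\<close> and \<open>w = \<Delta> u\<close> in the sense of
  distributions on the torus.\<close>

lift_definition weak_dx :: "torus_l2 \<Rightarrow> torus_l2 \<Rightarrow> bool" is
  "\<lambda>u g. \<forall>\<phi>. smooth_periodic \<phi> \<longrightarrow>
     (\<integral>z. g z * \<phi> z \<partial>torus) = - (\<integral>z. u z * pdx \<phi> z \<partial>torus)"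
  using l2_pairing_cong smooth_periodic_pdx smooth_periodic_measurable
  by (intro all_cong1 imp_cong refl arg_cong2[of _ _ _ _ "(=)"] arg_cong[of _ _ uminus]) auto

lift_definition weak_laplacian :: "torus_l2 \<Rightarrow> torus_l2 \<Rightarrow> bool" is
  "\<lambda>u w. \<forall>\<phi>. smooth_periodic \<phi> \<longrightarrow>
     (\<integral>z. w z * \<phi> z \<partial>torus) = (\<integral>z. u z * (pdx (pdx \<phi>) z + pdy (pdy \<phi>) z) \<partial>torus)"
  using l2_pairing_cong smooth_periodic_pdx smooth_periodic_pdy smooth_periodic_measurable
  by (intro all_cong1 imp_cong refl arg_cong2[of _ _ _ _ "(=)"]) (auto intro!: borel_measurable_add)

lift_definition mult_exp_iy :: "torus_l2 \<Rightarrow> torus_l2" is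
  "\<lambda>f (z :: real \<times> real). exp (\<i> * of_real (snd z)) * f z"
proof -
  have m: "(\<lambda>z. exp (\<i> * complex_of_real (snd z))) \<in> borel_measurable torus"
    by (intro borel_measurable_torusI borel_measurable_continuous_onI) (intro continuous_intros)
  fix f g :: "real \<times> real \<Rightarrow> complex"
  assume fg: "sq_integrable f \<and> sq_integrable g \<and> (AE z in torus. f z = g z)"
  have e: "sq_integrable (\<lambda>z. exp (\<i> * of_real (snd z)) * h z)" if "sq_integrable h" for h
    using that m by (rule sq_integrable_bounded_mult[where B = 1]) simp
  have "AE z in torus. exp (\<i> * of_real (snd z)) * f z = exp (\<i> * of_real (snd z)) * g z"
    using fg by auto
  then show "sq_integrable (\<lambda>z. exp (\<i> * of_real (snd z)) * f z) \<and>
      sq_integrable (\<lambda>z. exp (\<i> * of_real (snd z)) * g z) \<and>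
      (AE z in torus. exp (\<i> * of_real (snd z)) * f z = exp (\<i> * of_real (snd z)) * g z)"
    using e fg by blast
qed

text \<open>Graph of the operator \<open>A (u, v) = (-v, -\<Delta>u - e\<^sup>i\<^sup>y \<partial>\<^sub>x u)\<close> with domain \<open>H\<^sup>2 \<times> H\<^sup>1\<close>: here
  \<open>u\<close> and \<open>v\<close> both range over \<open>H\<^sup>1\<close>, and \<open>v\<close> enters the domain through the embedding into \<open>L\<^sup>2\<close>.\<close>

definition wave_op :: "((torus_h1 \<times> torus_l2) \<times> (torus_h1 \<times> torus_l2)) set" where
  "wave_op = {((u, l2_of_h1 v), (- v, - w - mult_exp_iy g)) | u v w g.
     l2_of_h1 u \<in> sobolev 2 \<and> weak_laplacian (l2_of_h1 u) w \<and> weak_dx (l2_of_h1 u) g}"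

end

theory Submission
  imports Defs
begin

text \<open>
  Write \<open>a\<^sub>k\<close> and \<open>b\<^sub>k\<close> for the Fourier coefficients of the two components of a solution
  \<open>T(t)x\<close>. The wave equation becomes \<open>a\<^sub>k' = b\<^sub>k\<close>, \<open>b\<^sub>k' = -|k|\<^sup>2 a\<^sub>k + i k\<^sub>1 a\<^sub>l\<close> with \<open>l = k - (0, 1)\<close>,
  because multiplication by \<open>e\<^sup>i\<^sup>y\<close> shifts the second frequency.

  \<^bold>\<open>Upper bound.\<close> The energy \<open>E = \<Sum>\<^sub>k |b\<^sub>k|\<^sup>2 + |k|\<^sup>2 |a\<^sub>k|\<^sup>2\<close> is the squared norm in \<open>H\<^sup>1 \<times> L\<^sup>2\<close> without
  the term \<open>|a\<^sub>0|\<^sup>2\<close>; that it includes the whole \<open>L\<^sup>2\<close> norm of the second component is Parseval's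
  identity (\<open>parseval\<close>). In its derivative the Laplacian cancels, and what remains is bounded by
  \<open>\<Sum>\<^sub>k |b\<^sub>k|\<^sup>2 + k\<^sub>1\<^sup>2 |a\<^sub>l|\<^sup>2 \<le> E\<close>. So \<open>|E'| \<le> E\<close> and \<open>E(t) \<le> e\<^bsup>|t|\<^esup> E(0)\<close> (\<open>energy_growth\<close>). The mode \<open>k = 0\<close>
  is not coupled to the others, since \<open>k\<^sub>1 = 0\<close>; it grows linearly (\<open>zero_mode_growth\<close>), which gives
  the factor \<open>1 + |t|\<close>. To differentiate, only finite partial sums of \<open>E\<close> are used; \<open>gronwall_sup\<close>
  passes to their supremum. The estimate on the domain of the generator extends to the whole space
  because trigonometric polynomials are dense and lie in the domain.

  \<^bold>\<open>Lower bound.\<close> The spectrum of the generator does not see the growth, but approximate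
  eigenvectors do. For \<open>\<sigma> = \<plusminus>1\<close> and \<open>\<mu> = \<sigma>/2 + i m\<close> take \<open>u = e\<^bsup>imx\<^esup> w(y)\<close> and \<open>v = \<mu>u\<close>. The generator
  minus \<open>\<mu>\<close> maps \<open>(u, v)\<close> to \<open>(0, e\<^bsup>imx\<^esup> (w'' - w/4 + i m (e\<^sup>i\<^sup>y - \<sigma>) w))\<close>. With the Dirichlet kernel
  \<open>w = \<Sum>\<^sub>j\<^sub><\<^sub>N \<sigma>\<^sup>j e\<^bsup>ijy\<^esup>\<close>, which concentrates where \<open>e\<^sup>i\<^sup>y = \<sigma>\<close>, the last term telescopes to two modes of
  size \<open>m\<close>, while the norm of \<open>u\<close> is at least \<open>m \<surd>N\<close>. For \<open>m\<close> large compared with \<open>N\<close> the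
  relative error is therefore of order \<open>1/\<surd>N\<close> (\<open>generator_quasimode\<close>). Comparing \<open>T(t)x\<close> with \<open>e\<^bsup>\<mu>t\<^esup>x\<close> on
  a fixed time interval and letting \<open>N\<close> tend to infinity gives \<open>\<parallel>T(t)\<parallel> \<ge> e\<^bsup>|t|/2\<^esup>\<close> (\<open>norm_group_ge\<close>), where
  \<open>\<sigma>\<close> is the sign of \<open>t\<close>. Both growth bounds follow from the two estimates.
\<close>

section \<open>Complex scalar multiplication\<close>

lemma bounded_bilinear_scaleC:
  "bounded_bilinear (\<lambda>c (x::'a::complex_normed_vector). c *\<^sub>C x)"
proof
  show "(r *\<^sub>R c) *\<^sub>C x = r *\<^sub>R c *\<^sub>C x" for r c and x :: 'a
    by (simp add: scaleC_scaleC scaleR_conv_of_real flip: scaleC_of_real)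
  show "c *\<^sub>C r *\<^sub>R x = r *\<^sub>R c *\<^sub>C x" for r c and x :: 'a
    by (simp add: scaleC_scaleC mult.commute flip: scaleC_of_real)
  show "\<exists>K. \<forall>c (x::'a). norm (c *\<^sub>C x) \<le> norm c * norm x * K"
    by (intro exI[of _ 1]) (simp add: norm_scaleC)
qed (simp_all add: scaleC_add_left scaleC_add_right)

lemma bounded_linear_scaleC: "bounded_linear (\<lambda>x::'a::complex_normed_vector. c *\<^sub>C x)"
  by (rule bounded_bilinear.bounded_linear_right[OF bounded_bilinear_scaleC])

lemma scaleC_one: "1 *\<^sub>C x = (x::'a::complex_normed_vector)"
  using scaleC_of_real[of 1 x] by simp

lemma scaleC_zero: "c *\<^sub>C (0::'a::complex_normed_vector) = 0"
  by (rule bounded_bilinear.zero_right[OF bounded_bilinear_scaleC])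

lemma scaleC_minus_left: "(- c) *\<^sub>C x = - (c *\<^sub>C (x::'a::complex_normed_vector))"
  by (rule bounded_bilinear.minus_left[OF bounded_bilinear_scaleC])

lemma scaleC_diff_right: "c *\<^sub>C (x - y) = c *\<^sub>C x - c *\<^sub>C (y::'a::complex_normed_vector)"
  by (rule bounded_bilinear.diff_right[OF bounded_bilinear_scaleC])

lemma scaleC_diff_left: "(c - d) *\<^sub>C x = c *\<^sub>C x - d *\<^sub>C (x::'a::complex_normed_vector)"
  by (rule bounded_bilinear.diff_left[OF bounded_bilinear_scaleC])

lemma scaleC_sum_right:
  "c *\<^sub>C sum f F = (\<Sum>k\<in>F. c *\<^sub>C (f k :: 'a::complex_normed_vector))"
  by (rule bounded_bilinear.sum_right[OF bounded_bilinear_scaleC])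

lemma sum_scaleC_Pair:
  "(\<Sum>k\<in>F. c k *\<^sub>C (f k, g k)) = (\<Sum>k\<in>F. c k *\<^sub>C f k, \<Sum>k\<in>F. c k *\<^sub>C g k)"
  for f :: "_ \<Rightarrow> 'a::complex_normed_vector" and g :: "_ \<Rightarrow> 'b::complex_normed_vector"
  by (induction F rule: infinite_finite_induct) (simp_all add: scaleC_prod_def zero_prod_def)

section \<open>Integration by parts on the torus\<close>

lemma integrable_torus_continuous:
  fixes f :: "real \<times> real \<Rightarrow> complex"
  assumes f: "continuous_on UNIV f"
  shows "integrable torus f"
  unfolding torus_def torus_square
  using borel_integrable_compact[OF compact_cbox continuous_on_subset[OF f subset_UNIV]]
  by (subst integrable_restrict_space) auto

lemma torus_integral_eq_integral:
  fixes f :: "real \<times> real \<Rightarrow> complex"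
  assumes f: "continuous_on UNIV f"
  shows "(\<integral>z. f z \<partial>torus) = integral (cbox (0, 0) (2 * pi, 2 * pi)) f"
proof -
  let ?Q = "cbox (0::real, 0::real) (2 * pi, 2 * pi)"
  have "(\<integral>z. f z \<partial>torus) = (LINT z:?Q|lborel. f z)"
    unfolding torus_def torus_square set_lebesgue_integral_def
    by (subst integral_restrict_space) auto
  also have "\<dots> = integral ?Q f"
    using borel_integrable_compact[OF compact_cbox continuous_on_subset[OF f subset_UNIV]]
    by (intro set_borel_integral_eq_integral(2)) (simp add: set_integrable_def)
  finally show ?thesis .
qed

lemma torus_integral_derivative_x:
  fixes f f' :: "real \<times> real \<Rightarrow> complex"
  assumes f': "continuous_on UNIV f'"
    and d: "\<And>x y. ((\<lambda>s. f (s, y)) has_vector_derivative f' (x, y)) (at x)"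
    and per: "\<And>y. f (2 * pi, y) = f (0, y)"
  shows "(\<integral>z. f' z \<partial>torus) = 0"
proof -
  have "(\<integral>z. f' z \<partial>torus) = integral (cbox (0, 0) (2 * pi, 2 * pi)) (\<lambda>(x, y). f' (x, y))"
    by (simp add: torus_integral_eq_integral[OF f'])
  also have "\<dots> = integral (cbox 0 (2 * pi)) (\<lambda>x. integral (cbox 0 (2 * pi)) (\<lambda>y. f' (x, y)))"
    using integral_prod_continuous[OF continuous_on_subset[OF f' subset_UNIV]] by simp
  also have "\<dots> = integral (cbox 0 (2 * pi)) (\<lambda>y. integral (cbox 0 (2 * pi)) (\<lambda>x. f' (x, y)))"
    by (rule integral_swap_continuous) (use continuous_on_subset[OF f' subset_UNIV] in simp)
  also have "\<dots> = integral (cbox 0 (2 * pi)) (\<lambda>y. 0)"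
    \<comment> \<open>after exchanging the order of integration, the inner integral runs over one period\<close>
  proof (rule arg_cong[where f = "integral _"], rule ext)
    fix y
    have "((\<lambda>x. f' (x, y)) has_integral f (2 * pi, y) - f (0, y)) {0..2 * pi}"
      by (rule fundamental_theorem_of_calculus) (auto intro: has_vector_derivative_at_within d)
    then show "integral (cbox 0 (2 * pi)) (\<lambda>x. f' (x, y)) = 0" using per[of y] by (simp add: integral_unique)
  qed
  finally show ?thesis by simp
qed

lemma torus_integral_derivative_y:
  fixes f f' :: "real \<times> real \<Rightarrow> complex"
  assumes f': "continuous_on UNIV f'"
    and d: "\<And>x y. ((\<lambda>s. f (x, s)) has_vector_derivative f' (x, y)) (at y)"
    and per: "\<And>x. f (x, 2 * pi) = f (x, 0)"
  shows "(\<integral>z. f' z \<partial>torus) = 0"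
proof -
  have "(\<integral>z. f' z \<partial>torus) = integral (cbox (0, 0) (2 * pi, 2 * pi)) (\<lambda>(x, y). f' (x, y))"
    by (simp add: torus_integral_eq_integral[OF f'])
  also have "\<dots> = integral (cbox 0 (2 * pi)) (\<lambda>x. integral (cbox 0 (2 * pi)) (\<lambda>y. f' (x, y)))"
    using integral_prod_continuous[OF continuous_on_subset[OF f' subset_UNIV]] by simp
  also have "\<dots> = integral (cbox 0 (2 * pi)) (\<lambda>x. 0)"
  proof (rule arg_cong[where f = "integral _"], rule ext)
    fix x
    have "((\<lambda>y. f' (x, y)) has_integral f (x, 2 * pi) - f (x, 0)) {0..2 * pi}"
      by (rule fundamental_theorem_of_calculus) (auto intro: has_vector_derivative_at_within d)
    then show "integral (cbox 0 (2 * pi)) (\<lambda>y. f' (x, y)) = 0" using per[of x] by (simp add: integral_unique)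
  qed
  finally show ?thesis by simp
qed

lemma continuous_fourier_char: "continuous_on A (fourier_char k)"
  unfolding fourier_char_def by (intro continuous_intros)

lemma fourier_char_derivative_x:
  "((\<lambda>s. fourier_char k (s, y)) has_vector_derivative
     \<i> * of_int (fst k) * fourier_char k (x, y)) (at x)"
proof -
  have "((\<lambda>w. exp (\<i> * (of_int (fst k) * w + of_int (snd k) * of_real y))) has_field_derivative
      \<i> * of_int (fst k) * fourier_char k (x, y)) (at (of_real x))"
    by (auto intro!: derivative_eq_intros simp: fourier_char_def cis_conv_exp)
  from has_vector_derivative_real_field[OF this] show ?thesis
    by (simp add: fourier_char_def cis_conv_exp)
qed

lemma fourier_char_derivative_y:
  "((\<lambda>s. fourier_char k (x, s)) has_vector_derivative
     \<i> * of_int (snd k) * fourier_char k (x, y)) (at y)"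
proof -
  have "((\<lambda>w. exp (\<i> * (of_int (fst k) * of_real x + of_int (snd k) * w))) has_field_derivative
      \<i> * of_int (snd k) * fourier_char k (x, y)) (at (of_real y))"
    by (auto intro!: derivative_eq_intros simp: fourier_char_def cis_conv_exp)
  from has_vector_derivative_real_field[OF this] show ?thesis
    by (simp add: fourier_char_def cis_conv_exp)
qed

lemma fourier_char_periodic:
  "fourier_char k (x + 2 * pi, y) = fourier_char k (x, y)"
  "fourier_char k (x, y + 2 * pi) = fourier_char k (x, y)"
proof -
  have "cis (t + of_int n * (2 * pi)) = cis t" for t and n :: int
    using cis_multiple_2pi[of "of_int n"] by (simp add: mult.commute flip: cis_mult)
  from this[of "of_int (fst k) * x + of_int (snd k) * y" "fst k"]
    this[of "of_int (fst k) * x + of_int (snd k) * y" "snd k"]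
  show "fourier_char k (x + 2 * pi, y) = fourier_char k (x, y)"
  "fourier_char k (x, y + 2 * pi) = fourier_char k (x, y)"
    by (simp_all add: fourier_char_def algebra_simps)
qed

lemma pdx_cmult_fourier_char:
  "pdx (\<lambda>z. c * fourier_char k z) = (\<lambda>z. (c * \<i> * of_int (fst k)) * fourier_char k z)"
proof (rule ext, clarify)
  fix x y
  have "((\<lambda>s. c * fourier_char k (s, y)) has_vector_derivative
      c * (\<i> * of_int (fst k) * fourier_char k (x, y))) (at x)"
    by (intro has_vector_derivative_mult_right fourier_char_derivative_x)
  then show "pdx (\<lambda>z. c * fourier_char k z) (x, y) = c * \<i> * of_int (fst k) * fourier_char k (x, y)"
    by (simp add: pdx_def vector_derivative_at mult.assoc)
qed

lemma pdy_cmult_fourier_char: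
  "pdy (\<lambda>z. c * fourier_char k z) = (\<lambda>z. (c * \<i> * of_int (snd k)) * fourier_char k z)"
proof (rule ext, clarify)
  fix x y
  have "((\<lambda>s. c * fourier_char k (x, s)) has_vector_derivative
      c * (\<i> * of_int (snd k) * fourier_char k (x, y))) (at y)"
    by (intro has_vector_derivative_mult_right fourier_char_derivative_y)
  then show "pdy (\<lambda>z. c * fourier_char k z) (x, y) = c * \<i> * of_int (snd k) * fourier_char k (x, y)"
    by (simp add: pdy_def vector_derivative_at mult.assoc)
qed

text \<open>The scalar is there for the coinduction: the multiples of a character are closed under both
  partial derivatives, a single character is not.\<close>

lemma smooth_periodic_cmult_fourier_char: "smooth_periodic (\<lambda>z. c * fourier_char k z)"
proof (coinduction arbitrary: c)
  case smooth_periodic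
  have dx: "(\<lambda>s. c * fourier_char k (s, y)) differentiable at x" for x y
    by (rule differentiableI_vector, rule has_vector_derivative_mult_right, rule fourier_char_derivative_x)
  have dy: "(\<lambda>s. c * fourier_char k (x, s)) differentiable at y" for x y
    by (rule differentiableI_vector, rule has_vector_derivative_mult_right, rule fourier_char_derivative_y)
  have "continuous_on UNIV (\<lambda>z. c * fourier_char k z)"
    by (intro continuous_intros continuous_fourier_char)
  moreover have "\<exists>d. pdx (\<lambda>z. c * fourier_char k z) = (\<lambda>z. d * fourier_char k z)"
    "\<exists>d. pdy (\<lambda>z. c * fourier_char k z) = (\<lambda>z. d * fourier_char k z)"
    by (blast intro: pdx_cmult_fourier_char pdy_cmult_fourier_char)+
  moreover have "\<forall>x y. c * fourier_char k (x + 2 * pi, y) = c * fourier_char k (x, y) \<and>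
      c * fourier_char k (x, y + 2 * pi) = c * fourier_char k (x, y)"
    by (simp add: fourier_char_periodic)
  moreover have "\<forall>x y. (\<lambda>s. c * fourier_char k (s, y)) differentiable at x \<and>
      (\<lambda>s. c * fourier_char k (x, s)) differentiable at y"
    using dx dy by blast
  ultimately show ?case
    by - (rule exI[of _ "\<lambda>z. c * fourier_char k z"], intro conjI disjI1; (rule refl | assumption))
qed

lemma smooth_periodic_fourier_char: "smooth_periodic (fourier_char k)"
  using smooth_periodic_cmult_fourier_char[of 1 k] by simp

text \<open>A nontrivial character is, up to a constant, one of its own partial derivatives.\<close>

lemma integral_fourier_char:
  "(\<integral>z. fourier_char k z \<partial>torus) = (if k = 0 then 4 * pi\<^sup>2 else 0)"
proof (cases "k = 0")
  case True
  have "integral (cbox (0, 0) (2 * pi, 2 * pi)) (\<lambda>z::real \<times> real. 1::complex) = of_real (4 * pi\<^sup>2)"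
    by (simp add: content_Pair power2_eq_square scaleR_conv_of_real)
  then show ?thesis
    using True torus_integral_eq_integral[of "\<lambda>_. 1"] by simp
next
  case False
  have c: "continuous_on UNIV (\<lambda>z. c * fourier_char k z)" for c
    by (intro continuous_intros continuous_fourier_char)
  have "(\<integral>z. \<i> * of_int (fst k) * fourier_char k z \<partial>torus) = 0"
    using fourier_char_periodic(1)[of k 0]
    by (intro torus_integral_derivative_x[OF c fourier_char_derivative_x]) simp
  moreover have "(\<integral>z. \<i> * of_int (snd k) * fourier_char k z \<partial>torus) = 0"
    using fourier_char_periodic(2)[of k _ 0]
    by (intro torus_integral_derivative_y[OF c fourier_char_derivative_y]) simp
  ultimately show ?thesis using False by (auto simp: prod_eq_iff)
qed

lemma measure_torus: "measure torus (space torus) = 4 * pi\<^sup>2"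
  using integral_fourier_char[of 0] by (simp add: complex_eq_iff power2_eq_square)

lemma smooth_periodicD:
  assumes "smooth_periodic \<phi>"
  shows "continuous_on UNIV \<phi>"
    and "\<phi> (x + 2 * pi, y) = \<phi> (x, y)" and "\<phi> (x, y + 2 * pi) = \<phi> (x, y)"
    and "((\<lambda>s. \<phi> (s, y)) has_vector_derivative pdx \<phi> (x, y)) (at x)"
    and "((\<lambda>s. \<phi> (x, s)) has_vector_derivative pdy \<phi> (x, y)) (at y)"
proof -
  have *: "continuous_on UNIV \<phi> \<and> (\<forall>x y. \<phi> (x + 2 * pi, y) = \<phi> (x, y) \<and> \<phi> (x, y + 2 * pi) = \<phi> (x, y)) \<and>
    (\<forall>x y. (\<lambda>s. \<phi> (s, y)) differentiable (at x) \<and> (\<lambda>s. \<phi> (x, s)) differentiable (at y))"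
    using assms by (rule smooth_periodic.cases) (intro conjI allI, simp_all only:)
  show "continuous_on UNIV \<phi>"
    using * by (rule conjunct1)
  show "\<phi> (x + 2 * pi, y) = \<phi> (x, y)" "\<phi> (x, y + 2 * pi) = \<phi> (x, y)"
    using *[THEN conjunct2, THEN conjunct1] by simp_all
  have d: "(\<lambda>s. \<phi> (s, y)) differentiable (at x)" "(\<lambda>s. \<phi> (x, s)) differentiable (at y)"
    using *[THEN conjunct2, THEN conjunct2] by iprover+
  show "((\<lambda>s. \<phi> (s, y)) has_vector_derivative pdx \<phi> (x, y)) (at x)"
    "((\<lambda>s. \<phi> (x, s)) has_vector_derivative pdy \<phi> (x, y)) (at y)"
    unfolding pdx_def pdy_def prod.case by (rule d[unfolded vector_derivative_works])+
qed

text \<open>The derivative of \<open>fourier_char k * \<phi>\<close> integrates to zero.\<close>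

lemma integral_pdx_fourier_char:
  assumes \<phi>: "smooth_periodic \<phi>"
  shows "(\<integral>z. fourier_char k z * pdx \<phi> z \<partial>torus)
    = - (\<i> * of_int (fst k)) * (\<integral>z. fourier_char k z * \<phi> z \<partial>torus)"
proof -
  let ?f = "\<lambda>z. fourier_char k z * pdx \<phi> z"
  let ?g = "\<lambda>z. (\<i> * of_int (fst k)) * (fourier_char k z * \<phi> z)"
  have c: "continuous_on UNIV ?f" "continuous_on UNIV ?g"
    by (intro continuous_intros continuous_fourier_char smooth_periodicD(1) smooth_periodic_pdx \<phi>)+
  have "((\<lambda>s. fourier_char k (s, y) * \<phi> (s, y)) has_vector_derivative ?f (x, y) + ?g (x, y)) (at x)" for x y
    using has_vector_derivative_mult[OF fourier_char_derivative_x[of k y x] smooth_periodicD(4)[OF \<phi>, of y x]]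
    by (simp add: mult.assoc)
  then have "(\<integral>z. ?f z + ?g z \<partial>torus) = 0"
    using fourier_char_periodic(1)[of k 0] smooth_periodicD(2)[OF \<phi>, of 0]
    by (intro torus_integral_derivative_x[where f = "\<lambda>z. fourier_char k z * \<phi> z"] continuous_on_add c) auto
  then have "(\<integral>z. ?f z \<partial>torus) + (\<integral>z. ?g z \<partial>torus) = 0"
    by (simp only: Bochner_Integration.integral_add[OF c[THEN integrable_torus_continuous]])
  then show ?thesis by (simp add: eq_neg_iff_add_eq_0)
qed

lemma integral_pdy_fourier_char:
  assumes \<phi>: "smooth_periodic \<phi>"
  shows "(\<integral>z. fourier_char k z * pdy \<phi> z \<partial>torus)
    = - (\<i> * of_int (snd k)) * (\<integral>z. fourier_char k z * \<phi> z \<partial>torus)"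
proof -
  let ?f = "\<lambda>z. fourier_char k z * pdy \<phi> z"
  let ?g = "\<lambda>z. (\<i> * of_int (snd k)) * (fourier_char k z * \<phi> z)"
  have c: "continuous_on UNIV ?f" "continuous_on UNIV ?g"
    by (intro continuous_intros continuous_fourier_char smooth_periodicD(1) smooth_periodic_pdy \<phi>)+
  have "((\<lambda>s. fourier_char k (x, s) * \<phi> (x, s)) has_vector_derivative ?f (x, y) + ?g (x, y)) (at y)" for x y
    using has_vector_derivative_mult[OF fourier_char_derivative_y[of k x y] smooth_periodicD(5)[OF \<phi>, of x y]]
    by (simp add: mult.assoc)
  then have "(\<integral>z. ?f z + ?g z \<partial>torus) = 0"
    using fourier_char_periodic(2)[of k _ 0] smooth_periodicD(3)[OF \<phi>, of _ 0]
    by (intro torus_integral_derivative_y[where f = "\<lambda>z. fourier_char k z * \<phi> z"] continuous_on_add c) auto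
  then have "(\<integral>z. ?f z \<partial>torus) + (\<integral>z. ?g z \<partial>torus) = 0"
    by (simp only: Bochner_Integration.integral_add[OF c[THEN integrable_torus_continuous]])
  then show ?thesis by (simp add: eq_neg_iff_add_eq_0)
qed

section \<open>Fourier modes\<close>

lemma sq_integrable_fourier_char: "sq_integrable (\<lambda>z. c * fourier_char k z)"
  by (rule sq_integrable_cmult) (simp add: sq_integrable_def)

text \<open>The factor makes the modes orthonormal, and \<open>fourier u k\<close> the coefficient of \<open>u\<close> at \<open>torus_mode k\<close>.\<close>

lift_definition torus_mode :: "int \<times> int \<Rightarrow> torus_l2" is
  "\<lambda>k z. 1 / (2 * pi) * fourier_char k z"
  by (intro conjI sq_integrable_fourier_char AE_I2 refl)

lemma fourier_torus_mode: "fourier (torus_mode k) l = (if k = l then 1 else 0)"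
proof transfer
  fix k l :: "int \<times> int"
  have "(\<integral>z. fourier_char (- l) z * (1 / (2 * pi) * fourier_char k z) \<partial>torus)
      = (\<integral>z. 1 / (2 * pi) * fourier_char (k - l) z \<partial>torus)"
    using fourier_char_mult[of "- l" _ k] by (simp add: mult.left_commute)
  also have "\<dots> = 1 / (2 * pi) * (if k = l then 4 * pi\<^sup>2 else 0)"
    by (simp add: integral_fourier_char)
  finally show "(\<integral>z. fourier_char (- l) z * (1 / (2 * pi) * fourier_char k z) \<partial>torus) / (2 * pi)
      = (if k = l then 1 else 0)"
    by (simp add: power2_eq_square)
qed

lemma fourier_minus: "fourier (- u) k = - fourier u k"
  by (simp add: uminus_torus_l2_def fourier_scaleC)

lemma fourier_diff: "fourier (u - v) k = fourier u k - fourier v k"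
  by (simp add: minus_torus_l2_def uminus_torus_l2_def fourier_add fourier_scaleC)

lemma fourier_sum: "fourier (sum f F) k = (\<Sum>i\<in>F. fourier (f i) k)"
  by (induction F rule: infinite_finite_induct) (simp_all add: fourier_add)

lemma fourier_scaleR: "fourier (r *\<^sub>R u) k = r *\<^sub>R fourier u k"
  by (simp add: scaleR_torus_l2_def fourier_scaleC scaleR_conv_of_real)

lemma exp_iy_eq_fourier_char: "exp (\<i> * of_real (snd z)) = fourier_char (0, 1) z"
  by (simp add: fourier_char_def cis_conv_exp)

lemma mult_exp_iy_torus_mode: "mult_exp_iy (torus_mode k) = torus_mode (k + (0, 1))"
proof transfer
  fix k :: "int \<times> int"
  have *: "exp (\<i> * of_real (snd z)) * (1 / (2 * pi) * fourier_char k z)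
      = 1 / (2 * pi) * fourier_char (k + (0, 1)) z" for z
    using fourier_char_mult[of "(0, 1)" z k] by (simp add: exp_iy_eq_fourier_char mult.left_commute add.commute)
  show "sq_integrable (\<lambda>z. exp (\<i> * of_real (snd z)) * (1 / (2 * pi) * fourier_char k z)) \<and>
      sq_integrable (\<lambda>z. 1 / (2 * pi) * fourier_char (k + (0, 1)) z) \<and>
      (AE z in torus. exp (\<i> * of_real (snd z)) * (1 / (2 * pi) * fourier_char k z)
        = 1 / (2 * pi) * fourier_char (k + (0, 1)) z)"
    unfolding * by (intro conjI sq_integrable_fourier_char AE_I2 refl)
qed

lemma mult_exp_iy_scaleC: "mult_exp_iy (c *\<^sub>C f) = c *\<^sub>C mult_exp_iy f"
proof transfer
  fix c and f :: "real \<times> real \<Rightarrow> complex"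
  assume "sq_integrable f \<and> sq_integrable f \<and> (AE z in torus. f z = f z)"
  then have f: "sq_integrable f" by simp
  have "sq_integrable (\<lambda>z. exp (\<i> * of_real (snd z)) * f z)"
    unfolding exp_iy_eq_fourier_char by (rule sq_integrable_bounded_mult[OF f, where B = 1]) auto
  from sq_integrable_cmult[OF this, of c]
  show "sq_integrable (\<lambda>z. exp (\<i> * of_real (snd z)) * (c * f z)) \<and>
      sq_integrable (\<lambda>z. c * (exp (\<i> * of_real (snd z)) * f z)) \<and>
      (AE z in torus. exp (\<i> * of_real (snd z)) * (c * f z) = c * (exp (\<i> * of_real (snd z)) * f z))"
    by (simp add: mult.left_commute)
qed

lemma fourier_mult_exp_iy: "fourier (mult_exp_iy g) k = fourier g (k - (0, 1))"
proof transfer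
  fix g k
  show "(\<integral>z. fourier_char (- k) z * (exp (\<i> * of_real (snd z)) * g z) \<partial>torus) / (2 * pi)
      = (\<integral>z. fourier_char (- (k - (0, 1))) z * g z \<partial>torus) / (2 * pi)"
    unfolding exp_iy_eq_fourier_char mult.assoc[symmetric] fourier_char_mult by (simp add: add.commute)
qed

text \<open>Characters are admissible test functions.\<close>

lemma fourier_weak_dx:
  assumes "weak_dx u g"
  shows "fourier g k = \<i> * of_int (fst k) * fourier u k"
  using assms
proof transfer
  fix u g k
  assume "\<forall>\<phi>. smooth_periodic \<phi> \<longrightarrow> (\<integral>z. g z * \<phi> z \<partial>torus) = - (\<integral>z. u z * pdx \<phi> z \<partial>torus)"
  from this[rule_format, OF smooth_periodic_fourier_char[of "- k"]]
  have "(\<integral>z. fourier_char (- k) z * g z \<partial>torus)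
      = - (\<integral>z. (- \<i> * of_int (fst k)) * (fourier_char (- k) z * u z) \<partial>torus)"
    using pdx_cmult_fourier_char[of 1 "- k"] by (simp add: mult.commute mult.left_commute)
  then show "(\<integral>z. fourier_char (- k) z * g z \<partial>torus) / (2 * pi)
      = \<i> * of_int (fst k) * ((\<integral>z. fourier_char (- k) z * u z \<partial>torus) / (2 * pi))"
    by simp
qed

lemma fourier_weak_laplacian:
  assumes "weak_laplacian u w"
  shows "fourier w k = - of_int ((fst k)\<^sup>2 + (snd k)\<^sup>2) * fourier u k"
  using assms
proof transfer
  fix u w k
  let ?c = "fourier_char (- k)"
  assume "\<forall>\<phi>. smooth_periodic \<phi> \<longrightarrow>
    (\<integral>z. w z * \<phi> z \<partial>torus) = (\<integral>z. u z * (pdx (pdx \<phi>) z + pdy (pdy \<phi>) z) \<partial>torus)"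
  from this[rule_format, OF smooth_periodic_fourier_char[of "- k"]]
  have *: "(\<integral>z. w z * ?c z \<partial>torus) = (\<integral>z. u z * (pdx (pdx ?c) z + pdy (pdy ?c) z) \<partial>torus)" .
  have "pdx (pdx ?c) z + pdy (pdy ?c) z = - of_int ((fst k)\<^sup>2 + (snd k)\<^sup>2) * ?c z" for z
    using pdx_cmult_fourier_char[of 1 "- k"] pdx_cmult_fourier_char[of "- \<i> * of_int (fst k)" "- k"]
      pdy_cmult_fourier_char[of 1 "- k"] pdy_cmult_fourier_char[of "- \<i> * of_int (snd k)" "- k"]
    by (simp add: algebra_simps power2_eq_square)
  with * have "(\<integral>z. ?c z * w z \<partial>torus)
      = (\<integral>z. - of_int ((fst k)\<^sup>2 + (snd k)\<^sup>2) * (?c z * u z) \<partial>torus)"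
    by (simp only: mult.commute mult.left_commute mult.assoc)
  then show "(\<integral>z. ?c z * w z \<partial>torus) / (2 * pi)
      = - of_int ((fst k)\<^sup>2 + (snd k)\<^sup>2) * ((\<integral>z. ?c z * u z \<partial>torus) / (2 * pi))"
    by (simp only: integral_mult_right_zero times_divide_eq_right)
qed

lemma weak_dx_torus_mode: "weak_dx (torus_mode k) ((\<i> * of_int (fst k)) *\<^sub>C torus_mode k)"
proof transfer
  fix k :: "int \<times> int"
  show "\<forall>\<phi>. smooth_periodic \<phi> \<longrightarrow>
      (\<integral>z. \<i> * of_int (fst k) * (1 / (2 * pi) * fourier_char k z) * \<phi> z \<partial>torus)
      = - (\<integral>z. 1 / (2 * pi) * fourier_char k z * pdx \<phi> z \<partial>torus)"
    using integral_pdx_fourier_char[of _ k] by (simp add: mult.assoc)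
qed

lemma weak_laplacian_torus_mode:
  "weak_laplacian (torus_mode k) (- of_int ((fst k)\<^sup>2 + (snd k)\<^sup>2) *\<^sub>C torus_mode k)"
proof (transfer, intro allI impI)
  fix k :: "int \<times> int" and \<phi>
  assume \<phi>: "smooth_periodic \<phi>"
  let ?I = "\<integral>z. fourier_char k z * \<phi> z \<partial>torus"
  have c: "continuous_on UNIV (\<lambda>z. fourier_char k z * \<psi> z)" if "smooth_periodic \<psi>" for \<psi>
    by (intro continuous_intros continuous_fourier_char smooth_periodicD(1) that)
  have "(\<integral>z. 1 / (2 * pi) * fourier_char k z * (pdx (pdx \<phi>) z + pdy (pdy \<phi>) z) \<partial>torus)
      = 1 / (2 * pi) * ((\<integral>z. fourier_char k z * pdx (pdx \<phi>) z \<partial>torus)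
        + (\<integral>z. fourier_char k z * pdy (pdy \<phi>) z \<partial>torus))"
    using integrable_torus_continuous[OF c[OF smooth_periodic_pdx[OF smooth_periodic_pdx[OF \<phi>]]]]
      integrable_torus_continuous[OF c[OF smooth_periodic_pdy[OF smooth_periodic_pdy[OF \<phi>]]]]
    by (simp add: distrib_left mult.assoc add_divide_distrib)
  also have "\<dots> = 1 / (2 * pi) * (- of_int ((fst k)\<^sup>2 + (snd k)\<^sup>2) * ?I)"
    by (simp add: integral_pdx_fourier_char integral_pdy_fourier_char smooth_periodic_pdx
        smooth_periodic_pdy \<phi> power2_eq_square algebra_simps)
  finally show "(\<integral>z. - of_int ((fst k)\<^sup>2 + (snd k)\<^sup>2) * (1 / (2 * pi) * fourier_char k z) * \<phi> z \<partial>torus)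
      = (\<integral>z. 1 / (2 * pi) * fourier_char k z * (pdx (pdx \<phi>) z + pdy (pdy \<phi>) z) \<partial>torus)"
    by (simp add: mult.assoc)
qed

section \<open>Parseval\<close>

lemma cmod_add_squared: "(cmod (a + b))\<^sup>2 = (cmod a)\<^sup>2 + 2 * Re (cnj b * a) + (cmod b)\<^sup>2"
  unfolding cmod_power2 by (simp add: power2_eq_square algebra_simps)

text \<open>This replaces the inner product of \<open>L\<^sup>2\<close>: all orthogonality that is needed, for trigonometric
  polynomials and for remainders, follows by adding one mode at a time.\<close>

lemma norm_add_torus_mode:
  "(norm (w + c *\<^sub>C torus_mode k))\<^sup>2 = (norm w)\<^sup>2 + 2 * Re (cnj c * fourier w k) + (cmod c)\<^sup>2"
proof transfer
  fix w k and c :: complex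
  assume "sq_integrable w \<and> sq_integrable w \<and> (AE z in torus. w z = w z)"
  then have w: "sq_integrable w" by simp
  let ?m = "\<lambda>z. 1 / (2 * pi) * fourier_char k z"
  have eq: "(cmod (w z + c * ?m z))\<^sup>2
     = (cmod (w z))\<^sup>2 + 2 * Re (cnj c / (2 * pi) * (fourier_char (- k) z * w z)) + (cmod c)\<^sup>2 / (4 * pi\<^sup>2)" for z
  proof -
    have cn: "cnj (fourier_char k z) = fourier_char (- k) z"
      by (simp add: fourier_char_def cis_cnj)
    have "(cmod (w z + c * ?m z))\<^sup>2 = (cmod (w z))\<^sup>2 + 2 * Re (cnj (c * ?m z) * w z) + (cmod (c * ?m z))\<^sup>2"
      by (rule cmod_add_squared)
    also have "cnj (c * ?m z) * w z = cnj c / (2 * pi) * (fourier_char (- k) z * w z)"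
      by (simp add: cn)
    also have "(cmod (c * ?m z))\<^sup>2 = (cmod c)\<^sup>2 / (4 * pi\<^sup>2)"
      by (simp add: norm_mult norm_divide power_divide power_mult_distrib)
    finally show ?thesis .
  qed
  have i: "integrable torus (\<lambda>z. (cmod (w z))\<^sup>2)"
    "integrable torus (\<lambda>z. cnj c / (2 * pi) * (fourier_char (- k) z * w z))"
    using w integrable_fourier_char_mult[OF w, of "- k"] by (auto simp: sq_integrable_def)
  define G where "G z = cnj c / (2 * pi) * (fourier_char (- k) z * w z)" for z
  have G: "integrable torus G" using i(2) by (simp add: G_def[abs_def])
  have "(\<integral>z. (cmod (w z + c * ?m z))\<^sup>2 \<partial>torus)
      = (\<integral>z. (cmod (w z))\<^sup>2 + 2 * Re (G z) + (cmod c)\<^sup>2 / (4 * pi\<^sup>2) \<partial>torus)"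
    unfolding eq G_def ..
  also have "\<dots> = (\<integral>z. (cmod (w z))\<^sup>2 \<partial>torus) + 2 * Re (\<integral>z. G z \<partial>torus) + (cmod c)\<^sup>2"
    using i(1) G by (simp add: measure_torus)
  also have "(\<integral>z. G z \<partial>torus) = (\<integral>z. cnj c / (2 * pi) * (fourier_char (- k) z * w z) \<partial>torus)"
    by (simp add: G_def[abs_def])
  also have "(\<integral>z. cnj c / (2 * pi) * (fourier_char (- k) z * w z) \<partial>torus)
      = cnj c * ((\<integral>z. fourier_char (- k) z * w z \<partial>torus) / (2 * pi))"
    by simp
  finally have *: "(\<integral>z. (cmod (w z + c * ?m z))\<^sup>2 \<partial>torus) = (\<integral>z. (cmod (w z))\<^sup>2 \<partial>torus)
      + 2 * Re (cnj c * ((\<integral>z. fourier_char (- k) z * w z \<partial>torus) / (2 * pi))) + (cmod c)\<^sup>2" .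
  have sq: "(sqrt (\<integral>z. (cmod (f z))\<^sup>2 \<partial>torus))\<^sup>2 = (\<integral>z. (cmod (f z))\<^sup>2 \<partial>torus)" for f
    by simp
  from * show "(sqrt (\<integral>z. (cmod (w z + c * ?m z))\<^sup>2 \<partial>torus))\<^sup>2
     = (sqrt (\<integral>z. (cmod (w z))\<^sup>2 \<partial>torus))\<^sup>2
        + 2 * Re (cnj c * ((\<integral>z. fourier_char (- k) z * w z \<partial>torus) / (2 * pi))) + (cmod c)\<^sup>2"
    unfolding sq .
qed

lemma norm_torus_mode: "norm (torus_mode k) = 1"
  using norm_add_torus_mode[of 0 1 k] power2_eq_iff_nonneg[of "norm (torus_mode k)" 1]
  by (simp add: scaleC_one)

definition trig_poly :: "(int \<times> int) set \<Rightarrow> (int \<times> int \<Rightarrow> complex) \<Rightarrow> torus_l2" where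
  "trig_poly F c = (\<Sum>k\<in>F. c k *\<^sub>C torus_mode k)"

lemma fourier_trig_poly:
  "finite F \<Longrightarrow> fourier (trig_poly F c) k = (if k \<in> F then c k else 0)"
  by (simp add: trig_poly_def fourier_sum fourier_scaleC fourier_torus_mode if_distrib[of "(*) _"] sum.delta
      cong: if_cong)

lemma norm_trig_poly: "finite F \<Longrightarrow> (norm (trig_poly F c))\<^sup>2 = (\<Sum>k\<in>F. (cmod (c k))\<^sup>2)"
proof (induction F rule: finite_induct)
  case (insert k F)
  then have "trig_poly (insert k F) c = trig_poly F c + c k *\<^sub>C torus_mode k"
    by (simp add: trig_poly_def add.commute)
  with insert show ?case by (simp add: norm_add_torus_mode fourier_trig_poly)
qed (simp add: trig_poly_def)

lemma norm_diff_trig_poly: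
  "finite F \<Longrightarrow> (norm (u - trig_poly F (fourier u)))\<^sup>2 = (norm u)\<^sup>2 - (\<Sum>k\<in>F. (cmod (fourier u k))\<^sup>2)"
proof (induction F rule: finite_induct)
  case (insert k F)
  let ?r = "u - trig_poly F (fourier u)"
  have eq: "u - trig_poly (insert k F) (fourier u) = ?r + (- fourier u k) *\<^sub>C torus_mode k"
    using insert by (simp add: trig_poly_def scaleC_minus_left algebra_simps)
  have "fourier ?r k = fourier u k"
    using insert by (simp add: fourier_diff fourier_trig_poly)
  moreover have "cnj (fourier u k) * fourier u k = of_real ((cmod (fourier u k))\<^sup>2)"
    by (simp only: mult.commute[of "cnj _"] complex_norm_square)
  ultimately show ?case
    using insert norm_add_torus_mode[of ?r "- fourier u k" k] unfolding eq by simp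
qed (simp add: trig_poly_def)

lemma bessel_inequality: "finite F \<Longrightarrow> (\<Sum>k\<in>F. (cmod (fourier u k))\<^sup>2) \<le> (norm u)\<^sup>2"
  using norm_diff_trig_poly[of F u] zero_le_power2[of "norm (u - trig_poly F (fourier u))"] by linarith

lemma cmod_fourier_le: "cmod (fourier u k) \<le> norm u"
  using bessel_inequality[of "{k}" u] by (auto intro: power2_le_imp_le)

lemma sq_integrable_rep_torus_l2: "sq_integrable (rep_torus_l2 u)"
  using Quotient_rep_reflp[OF Quotient_torus_l2, of u] by simp

lemma norm_abs_torus_l2:
  "sq_integrable f \<Longrightarrow> norm (abs_torus_l2 f) = sqrt (\<integral>z. (cmod (f z))\<^sup>2 \<partial>torus)"
  by (rule norm_torus_l2.abs_eq) simp

text \<open>On a finite measure space the \<open>L\<^sup>2\<close> norm controls the \<open>L\<^sup>1\<close> norm. The constant is not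
  optimal; it only has to be uniform.\<close>

lemma integral_cmod_rep_torus_l2_le:
  assumes "norm u \<le> a" "a > 0"
  shows "(\<integral>z. cmod (rep_torus_l2 u z) \<partial>torus) \<le> (4 * pi\<^sup>2 + 1) / 2 * a"
proof -
  let ?f = "rep_torus_l2 u"
  have sq: "sq_integrable ?f" by (rule sq_integrable_rep_torus_l2)
  have i: "integrable torus (\<lambda>z. (cmod (?f z))\<^sup>2)" "integrable torus (\<lambda>z. cmod (?f z))"
    using sq sq_integrable_imp_integrable[OF sq] by (auto simp: sq_integrable_def)
  \<comment> \<open>the weight \<open>a\<close> makes both terms of the inequality between the means linear in \<open>a\<close>
    after integration\<close>
  have pt: "t \<le> a / 2 + t\<^sup>2 / (2 * a)" for t :: real
    using zero_le_power2[of "a - t"] assms(2) by (simp add: field_simps power2_eq_square)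
  have n: "(\<integral>z. (cmod (?f z))\<^sup>2 \<partial>torus) = (norm u)\<^sup>2"
    by (simp add: norm_torus_l2.rep_eq)
  have "(\<integral>z. cmod (?f z) \<partial>torus) \<le> (\<integral>z. a / 2 + (cmod (?f z))\<^sup>2 / (2 * a) \<partial>torus)"
    using i pt by (intro integral_mono) auto
  also have "\<dots> = a / 2 * (4 * pi\<^sup>2) + (norm u)\<^sup>2 / (2 * a)"
    using i n by (simp add: measure_torus)
  also have "(norm u)\<^sup>2 / (2 * a) \<le> a\<^sup>2 / (2 * a)"
    using assms by (intro divide_right_mono power_mono) auto
  finally show ?thesis using assms(2) by (simp add: field_simps power2_eq_square)
qed

text \<open>A substitute for the completeness of \<open>L\<^sup>2\<close> that produces no limit in \<open>L\<^sup>2\<close>. Along a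
  rapidly convergent sequence the limit exists in \<open>L\<^sup>1\<close> and almost everywhere; its Fourier
  coefficients identify it with \<open>v\<close>, and Fatou's lemma bounds the norm of \<open>v\<close>.\<close>

lemma norm_le_if_fourier_tendsto:
  fixes S :: "nat \<Rightarrow> torus_l2"
  assumes cauchy: "\<And>j. norm (S (Suc j) - S j) \<le> (1 / 2) ^ j"
    and coef: "\<And>k. (\<lambda>j. fourier (S j) k) \<longlonglongrightarrow> fourier v k"
    and bdd: "\<And>j. norm (S j) \<le> c"
  shows "norm v \<le> c"
proof -
  define D where "D j = rep_torus_l2 (S (Suc j) - S j)" for j
  define P where "P n z = rep_torus_l2 (S 0) z + (\<Sum>j<n. D j z)" for n z
  define h where "h z = rep_torus_l2 (S 0) z + (\<Sum>j. D j z)" for z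
  have Dsq: "sq_integrable (D j)" for j unfolding D_def by (rule sq_integrable_rep_torus_l2)
  have P: "sq_integrable (P n) \<and> abs_torus_l2 (P n) = S n" for n
  proof (induction n)
    case 0
    then show ?case
      using Quotient_abs_rep[OF Quotient_torus_l2] sq_integrable_rep_torus_l2
      by (simp add: P_def[abs_def])
  next
    case (Suc n)
    have eq: "P (Suc n) = (\<lambda>z. P n z + D n z)" by (simp add: P_def[abs_def] add.assoc)
    have "abs_torus_l2 (\<lambda>z. P n z + D n z) = abs_torus_l2 (P n) + abs_torus_l2 (D n)"
      by (rule plus_torus_l2.abs_eq[symmetric]) (use Suc Dsq in auto)
    also have "\<dots> = S (Suc n)"
      using Suc Quotient_abs_rep[OF Quotient_torus_l2, of "S (Suc n) - S n"] by (simp add: D_def)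
    finally show ?case using Suc Dsq sq_integrable_add unfolding eq by blast
  qed
  have [measurable]: "D j \<in> borel_measurable torus" "P j \<in> borel_measurable torus"
    "rep_torus_l2 w \<in> borel_measurable torus" for j w
    using Dsq P sq_integrable_rep_torus_l2 by (auto intro: sq_integrable_measurable)
  have Dint: "integrable torus (D j)" for j
    by (rule sq_integrable_imp_integrable[OF Dsq])
  let ?C = "(4 * pi\<^sup>2 + 1) / 2"
  have D1: "(\<integral>z. cmod (D j z) \<partial>torus) \<le> ?C * (1 / 2) ^ j" for j
    unfolding D_def by (rule integral_cmod_rep_torus_l2_le[OF cauchy]) simp
  have sumD: "summable (\<lambda>j. \<integral>z. cmod (D j z) \<partial>torus)"
    by (rule summable_comparison_test'[where g = "\<lambda>j. ?C * (1 / 2) ^ j" and N = 0])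
      (use D1 in \<open>auto intro!: summable_mult summable_geometric\<close>)
  \<comment> \<open>the increments are absolutely summable in \<open>L\<^sup>1\<close>, so their series converges almost
    everywhere and its integral against a character can be computed term by term\<close>
  have "(\<integral>\<^sup>+z. (\<Sum>j. ennreal (cmod (D j z))) \<partial>torus) = (\<Sum>j. \<integral>\<^sup>+z. ennreal (cmod (D j z)) \<partial>torus)"
    by (rule nn_integral_suminf) measurable
  also have "\<dots> = (\<Sum>j. ennreal (\<integral>z. cmod (D j z) \<partial>torus))"
    using Dint by (intro arg_cong[where f = suminf] ext nn_integral_eq_integral) auto
  also have "\<dots> = ennreal (\<Sum>j. \<integral>z. cmod (D j z) \<partial>torus)"
    using sumD by (intro suminf_ennreal2) auto
  finally have "(\<integral>\<^sup>+z. (\<Sum>j. ennreal (cmod (D j z))) \<partial>torus) \<noteq> \<infinity>" by simp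
  then have "AE z in torus. (\<Sum>j. ennreal (cmod (D j z))) \<noteq> \<infinity>"
    by (intro nn_integral_PInf_AE) measurable
  then have AEsum: "AE z in torus. summable (\<lambda>j. cmod (D j z))"
    by eventually_elim (auto intro!: summable_suminf_not_top)
  have Dsum_int: "integrable torus (\<lambda>z. \<Sum>j. D j z)"
    by (rule integrable_suminf[OF Dint AEsum sumD])
  have hint: "integrable torus h"
    unfolding h_def[abs_def]
    by (intro Bochner_Integration.integrable_add Dsum_int sq_integrable_imp_integrable
        sq_integrable_rep_torus_l2)
  have mult_int: "integrable torus (\<lambda>z. f z * fourier_char k z)"
    if "integrable torus f" for f k
    by (rule integrable_mult_bounded[OF that, where B = 1]) auto
  have coef_h: "(\<integral>z. h z * fourier_char k z \<partial>torus)
      = (\<integral>z. rep_torus_l2 v z * fourier_char k z \<partial>torus)" for k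
  proof -
    have four: "(\<integral>z. rep_torus_l2 w z * fourier_char k z \<partial>torus) = 2 * pi * fourier w (- k)" for w
      by (simp add: fourier.rep_eq mult.commute)
    have "(\<lambda>j. \<integral>z. D j z * fourier_char k z \<partial>torus) sums (\<integral>z. (\<Sum>j. D j z * fourier_char k z) \<partial>torus)"
      using AEsum sumD
      by (intro sums_integral mult_int Dint) (simp_all add: norm_mult)
    also have "(\<integral>z. (\<Sum>j. D j z * fourier_char k z) \<partial>torus)
       = (\<integral>z. (\<Sum>j. D j z) * fourier_char k z \<partial>torus)"
    proof (rule integral_cong_AE)
      show "AE z in torus. (\<Sum>j. D j z * fourier_char k z) = (\<Sum>j. D j z) * fourier_char k z"
        using AEsum by eventually_elim (auto intro!: suminf_mult2[symmetric] summable_norm_cancel)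
    qed measurable
    finally have "(\<lambda>n. (\<Sum>j<n. 2 * pi * fourier (S (Suc j) - S j) (- k)))
        \<longlonglongrightarrow> (\<integral>z. (\<Sum>j. D j z) * fourier_char k z \<partial>torus)"
      unfolding sums_def D_def four .
    moreover have "(\<Sum>j<n. 2 * pi * fourier (S (Suc j) - S j) (- k))
        = 2 * pi * (fourier (S n) (- k) - fourier (S 0) (- k))" for n
      by (simp only: fourier_diff sum_distrib_left[symmetric]
          sum_lessThan_telescope[where f = "\<lambda>n. fourier (S n) (- k)"])
    ultimately have "(\<lambda>n. 2 * pi * (fourier (S n) (- k) - fourier (S 0) (- k)))
        \<longlonglongrightarrow> (\<integral>z. (\<Sum>j. D j z) * fourier_char k z \<partial>torus)"
      by simp
    moreover have "(\<lambda>n. 2 * pi * (fourier (S n) (- k) - fourier (S 0) (- k)))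
        \<longlonglongrightarrow> 2 * pi * (fourier v (- k) - fourier (S 0) (- k))"
      by (intro tendsto_intros coef)
    ultimately have "(\<integral>z. (\<Sum>j. D j z) * fourier_char k z \<partial>torus)
        = 2 * pi * (fourier v (- k) - fourier (S 0) (- k))"
      by (rule LIMSEQ_unique)
    then show ?thesis
      unfolding h_def distrib_right
      using mult_int[OF Dsum_int, of k]
        mult_int[OF sq_integrable_imp_integrable[OF sq_integrable_rep_torus_l2[of "S 0"]], of k]
      by (simp add: four) (simp add: algebra_simps)
  qed
  have vint: "integrable torus (rep_torus_l2 v)"
    by (intro sq_integrable_imp_integrable sq_integrable_rep_torus_l2)
  \<comment> \<open>the limit is so far only known to be in \<open>L\<^sup>1\<close>, hence uniqueness has to be that of
    Fourier coefficients of \<open>L\<^sup>1\<close> functions\<close>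
  have "AE z in torus. h z - rep_torus_l2 v z = 0"
  proof (rule fourier_unique_aux)
    show "integrable torus (\<lambda>z. h z - rep_torus_l2 v z)" using hint vint by simp
    show "(\<integral>z. (h z - rep_torus_l2 v z) * fourier_char k z \<partial>torus) = 0" for k
      using mult_int[OF hint, of k] mult_int[OF vint, of k]
      by (simp add: left_diff_distrib coef_h)
  qed
  with AEsum have lim: "AE z in torus. (\<lambda>n. ennreal ((cmod (P n z))\<^sup>2)) \<longlonglongrightarrow> ennreal ((cmod (rep_torus_l2 v z))\<^sup>2)"
  proof eventually_elim
    case (elim z)
    have "(\<lambda>n. \<Sum>j<n. D j z) \<longlonglongrightarrow> (\<Sum>j. D j z)"
      by (rule summable_LIMSEQ[OF summable_norm_cancel[OF elim(1)]])
    then have "(\<lambda>n. P n z) \<longlonglongrightarrow> h z"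
      unfolding P_def h_def by (rule tendsto_add[OF tendsto_const])
    then have "(\<lambda>n. P n z) \<longlonglongrightarrow> rep_torus_l2 v z" using elim(2) by simp
    then show ?case by (intro tendsto_ennrealI tendsto_power tendsto_norm)
  qed
  \<comment> \<open>the uniform \<open>L\<^sup>2\<close> bound on the partial sums passes to their limit by Fatou's lemma\<close>
  have c0: "c \<ge> 0" using bdd[of 0] norm_ge_zero[of "S 0"] by linarith
  have Pc: "(\<integral>\<^sup>+z. ennreal ((cmod (P n z))\<^sup>2) \<partial>torus) \<le> ennreal (c\<^sup>2)" for n
  proof -
    have "(\<integral>z. (cmod (P n z))\<^sup>2 \<partial>torus) = (norm (S n))\<^sup>2"
      using norm_abs_torus_l2[of "P n"] P[of n] by simp
    also have "\<dots> \<le> c\<^sup>2" by (intro power_mono bdd) simp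
    finally show ?thesis
      using P[of n] by (subst nn_integral_eq_integral) (auto simp: sq_integrable_def intro!: ennreal_leI)
  qed
  have "(\<integral>\<^sup>+z. ennreal ((cmod (rep_torus_l2 v z))\<^sup>2) \<partial>torus)
      = (\<integral>\<^sup>+z. liminf (\<lambda>n. ennreal ((cmod (P n z))\<^sup>2)) \<partial>torus)"
  proof (rule nn_integral_cong_AE)
    show "AE z in torus. ennreal ((cmod (rep_torus_l2 v z))\<^sup>2) = liminf (\<lambda>n. ennreal ((cmod (P n z))\<^sup>2))"
      using lim by eventually_elim (rule lim_imp_Liminf[symmetric, OF sequentially_bot])
  qed
  also have "\<dots> \<le> liminf (\<lambda>n. \<integral>\<^sup>+z. ennreal ((cmod (P n z))\<^sup>2) \<partial>torus)"
    by (rule nn_integral_liminf) measurable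
  also have "\<dots> \<le> liminf (\<lambda>n::nat. ennreal (c\<^sup>2))"
    by (intro Liminf_mono always_eventually allI Pc)
  also have "\<dots> = ennreal (c\<^sup>2)" by (simp add: Liminf_const)
  finally have "ennreal (\<integral>z. (cmod (rep_torus_l2 v z))\<^sup>2 \<partial>torus) \<le> ennreal (c\<^sup>2)"
    using sq_integrable_rep_torus_l2[of v]
    by (subst (asm) nn_integral_eq_integral) (auto simp: sq_integrable_def)
  then have "(\<integral>z. (cmod (rep_torus_l2 v z))\<^sup>2 \<partial>torus) \<le> c\<^sup>2" by simp
  then show ?thesis
    unfolding norm_torus_l2.rep_eq using c0 by (intro real_le_lsqrt) auto
qed

text \<open>Bessel's inequality gives one direction. For the other one, the partial Fourier sums over suitable
  finite sets form a rapidly convergent sequence with norms below the sum of the series.\<close>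

lemma parseval: "((\<lambda>k. (cmod (fourier v k))\<^sup>2) has_sum (norm v)\<^sup>2) UNIV"
proof -
  let ?a = "\<lambda>k. (cmod (fourier v k))\<^sup>2"
  have s: "?a summable_on UNIV"
    by (rule nonneg_bounded_partial_sums_imp_summable_on[where C = "(norm v)\<^sup>2"])
      (auto intro!: eventually_finite_subsets_at_top_weakI bessel_inequality)
  let ?s = "infsum ?a UNIV"
  have le: "sum ?a F \<le> ?s" if "finite F" for F
    using that s by (intro finite_sum_le_infsum) auto
  have "\<exists>F. finite F \<and> ?s - sum ?a F \<le> ((1 / 2) ^ j)\<^sup>2" for j :: nat
  proof -
    have "((1 / 2) ^ j)\<^sup>2 > (0::real)" by simp
    from tendstoD[OF infsum_tendsto[OF s] this] obtain F where "finite F"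
      "dist (sum ?a F) ?s < ((1 / 2) ^ j)\<^sup>2"
      unfolding eventually_finite_subsets_at_top by blast
    then show ?thesis
      by (intro exI[of _ F] conjI) (auto simp: dist_real_def simp del: power_divide)
  qed
  then obtain F where F: "\<And>j. finite (F j)" "\<And>j. ?s - sum ?a (F j) \<le> ((1 / 2) ^ j)\<^sup>2" by metis
  \<comment> \<open>unions make the index sets increasing, so that the increments are again orthogonal sums\<close>
  define G where "G j = (\<Union>i\<le>j. F i)" for j
  have G: "finite (G j)" "G j \<subseteq> G (Suc j)" for j
    using F(1) by (auto simp: G_def atMost_Suc)
  have Ga: "?s - sum ?a (G j) \<le> ((1 / 2) ^ j)\<^sup>2" for j
  proof -
    have "sum ?a (F j) \<le> sum ?a (G j)"
      using G(1)[of j] by (intro sum_mono2) (auto simp: G_def)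
    with F(2)[of j] show ?thesis by linarith
  qed
  define S where "S j = trig_poly (G j) (fourier v)" for j
  have "norm v \<le> sqrt ?s"
  proof (rule norm_le_if_fourier_tendsto)
    fix j
    have "S (Suc j) = S j + trig_poly (G (Suc j) - G j) (fourier v)"
      using sum.subset_diff[OF G(2) G(1), of "\<lambda>k. fourier v k *\<^sub>C torus_mode k" j]
      by (simp add: S_def trig_poly_def add.commute)
    then have "(norm (S (Suc j) - S j))\<^sup>2 = sum ?a (G (Suc j) - G j)"
      by (simp add: norm_trig_poly G)
    also have "\<dots> = sum ?a (G (Suc j)) - sum ?a (G j)"
      using G by (intro sum_diff)
    also have "\<dots> \<le> ((1 / 2) ^ j)\<^sup>2"
      using le[OF G(1)[of "Suc j"]] Ga[of j] by linarith
    finally show "norm (S (Suc j) - S j) \<le> (1 / 2) ^ j"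
      by (rule power2_le_imp_le) simp
    have "sqrt (sum ?a (G j)) = norm (S j)"
      by (rule real_sqrt_unique) (simp_all add: S_def norm_trig_poly G)
    then show "norm (S j) \<le> sqrt ?s" using real_sqrt_le_mono[OF le[OF G(1)[of j]]] by simp
  next
    fix k
    have b: "cmod (fourier (S j) k - fourier v k) \<le> (1 / 2) ^ j" for j
      \<comment> \<open>an index outside every \<open>G j\<close> is possible, but its coefficient is below every remainder\<close>
    proof (cases "k \<in> G j")
      case False
      have "?a k + sum ?a (G j) \<le> ?s"
        using le[of "insert k (G j)"] False G(1) by simp
      with Ga[of j] have "?a k \<le> ((1 / 2) ^ j)\<^sup>2" by linarith
      then have "cmod (fourier v k) \<le> (1 / 2) ^ j" by (rule power2_le_imp_le) simp
      with False show ?thesis by (simp add: S_def fourier_trig_poly G)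
    qed (simp add: S_def fourier_trig_poly G)
    have p: "(\<lambda>j. (1 / 2) ^ j :: real) \<longlonglongrightarrow> 0" by (rule LIMSEQ_realpow_zero) auto
    have "(\<lambda>j. fourier (S j) k - fourier v k) \<longlonglongrightarrow> 0"
      by (rule Lim_null_comparison[OF always_eventually[OF allI[OF b]] p])
    then show "(\<lambda>j. fourier (S j) k) \<longlonglongrightarrow> fourier v k"
      by (simp add: LIM_zero_iff)
  qed
  moreover have "?s \<ge> 0" by (intro infsum_nonneg) auto
  ultimately have "(norm v)\<^sup>2 \<le> ?s"
    using power_mono[of "norm v" "sqrt ?s" 2] by simp
  moreover have "?s \<le> (norm v)\<^sup>2"
    using s by (intro infsum_le_finite_sums bessel_inequality) auto
  ultimately have "?s = (norm v)\<^sup>2" by (rule order_antisym[rotated])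
  with has_sum_infsum[OF s] show ?thesis by simp
qed

section \<open>Sobolev spaces and density of trigonometric polynomials\<close>

lemma sobolev_term_0: "sobolev_term 0 u k = (cmod (fourier u k))\<^sup>2"
  by (auto simp: sobolev_term_def prod_eq_iff zero_prod_def)

lemma sobolev_term_1:
  "sobolev_term 1 u k
    = (if k = 0 then 1 else of_int ((fst k)\<^sup>2 + (snd k)\<^sup>2)) * (cmod (fourier u k))\<^sup>2"
  by (auto simp: sobolev_term_def norm_prod_def)

text \<open>By Parseval, \<open>L\<^sup>2\<close> is the Sobolev space of order zero, with the same norm. Hence one argument
  treats convergence of Fourier series in both components of the state space.\<close>

lemma sobolev_0: "u \<in> sobolev 0"
  using has_sum_imp_summable[OF parseval[of u]] by (simp add: sobolev_def sobolev_term_0[abs_def])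

lemma sobolev_norm_0: "sobolev_norm 0 u = norm u"
  using parseval[of u] by (simp add: sobolev_norm_def sobolev_term_0 infsumI)

lemma sobolev_norm_has_sum:
  "u \<in> sobolev s \<Longrightarrow> (sobolev_term s u has_sum (sobolev_norm s u)\<^sup>2) UNIV"
  by (simp add: sobolev_norm_def sobolev_def infsum_nonneg sobolev_term_nonneg)

lemma sobolev_trig_poly: "finite F \<Longrightarrow> trig_poly F c \<in> sobolev s"
  unfolding sobolev_def mem_Collect_eq
  by (rule finite_nonzero_values_imp_summable_on, rule finite_subset[of _ F])
    (auto simp: sobolev_term_def fourier_trig_poly split: if_splits)

lemma torus_mode_sobolev: "torus_mode k \<in> sobolev s"
  using sobolev_trig_poly[of "{k}" "\<lambda>_. 1" s] by (simp add: trig_poly_def scaleC_one)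

lemma sobolev_partial_sum_tendsto:
  assumes u: "u \<in> sobolev s"
  shows "((\<lambda>F. sobolev_norm s (u - trig_poly F (fourier u))) \<longlongrightarrow> 0) (finite_subsets_at_top UNIV)"
proof -
  let ?S = "(sobolev_norm s u)\<^sup>2"
  have hs: "(sobolev_term s u has_sum ?S) UNIV" by (rule sobolev_norm_has_sum[OF u])
  have eq: "sqrt (?S - sum (sobolev_term s u) F) = sobolev_norm s (u - trig_poly F (fourier u))" if F: "finite F" for F
  proof -
    have "(sobolev_term s u has_sum sum (sobolev_term s u) F) F" using F by (rule has_sum_finite)
    then have "(sobolev_term s u has_sum (?S - sum (sobolev_term s u) F)) (UNIV - F)"
      using hs by (intro has_sum_Diff) auto
    then have "(sobolev_term s (u - trig_poly F (fourier u)) has_sum (?S - sum (sobolev_term s u) F)) UNIV"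
      by (rule has_sum_cong_neutral[THEN iffD1, rotated -1])
        (auto simp: sobolev_term_def fourier_diff fourier_trig_poly F)
    then show ?thesis by (simp add: sobolev_norm_def infsumI)
  qed
  have "((\<lambda>F. sqrt (?S - sum (sobolev_term s u) F)) \<longlongrightarrow> sqrt (?S - ?S)) (finite_subsets_at_top UNIV)"
    using hs unfolding has_sum_def by (intro tendsto_intros)
  then have "((\<lambda>F. sqrt (?S - sum (sobolev_term s u) F)) \<longlongrightarrow> 0) (finite_subsets_at_top UNIV)"
    by simp
  then show ?thesis
    by (rule Lim_transform_eventually)
      (use eq in \<open>auto intro!: eventually_finite_subsets_at_top_weakI\<close>)
qed

lemma l2_of_h1_minus: "l2_of_h1 (- u) = - l2_of_h1 u"
  by (simp add: uminus_torus_h1_def scaleC_torus_h1.rep_eq uminus_torus_l2_def)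

lemma l2_of_h1_diff: "l2_of_h1 (u - v) = l2_of_h1 u - l2_of_h1 v"
  by (simp add: minus_torus_h1_def uminus_torus_h1_def plus_torus_h1.rep_eq scaleC_torus_h1.rep_eq
      minus_torus_l2_def uminus_torus_l2_def)

lemma l2_of_h1_scaleR: "l2_of_h1 (r *\<^sub>R u) = r *\<^sub>R l2_of_h1 u"
  by (simp add: scaleR_torus_h1_def scaleC_torus_h1.rep_eq scaleR_torus_l2_def)

lemma l2_of_h1_sum: "l2_of_h1 (sum f F) = (\<Sum>k\<in>F. l2_of_h1 (f k))"
  by (induction F rule: infinite_finite_induct) (simp_all add: zero_torus_h1.rep_eq plus_torus_h1.rep_eq)

lemma h1_norm_has_sum: "(sobolev_term 1 (l2_of_h1 u) has_sum (norm u)\<^sup>2) UNIV"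
  using sobolev_norm_has_sum[OF l2_of_h1[of u]] by (simp add: norm_torus_h1.rep_eq)

lemma cmod_fourier_h1_le: "cmod (fourier (l2_of_h1 u) k) \<le> norm u"
proof -
  have one: "1 \<le> (fst k)\<^sup>2 + (snd k)\<^sup>2" if "k \<noteq> 0"
  proof -
    have "fst k \<noteq> 0 \<or> snd k \<noteq> 0" using that by (auto simp: prod_eq_iff)
    then have "(fst k)\<^sup>2 + (snd k)\<^sup>2 > 0" by (auto simp: sum_power2_gt_zero_iff)
    then show ?thesis by simp
  qed
  then have "1 \<le> (real_of_int ((fst k)\<^sup>2 + (snd k)\<^sup>2))" if "k \<noteq> 0"
    using that by (metis of_int_1 of_int_le_iff)
  then have "(cmod (fourier (l2_of_h1 u) k))\<^sup>2 \<le> sobolev_term 1 (l2_of_h1 u) k"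
    using mult_right_mono[of 1 "real_of_int ((fst k)\<^sup>2 + (snd k)\<^sup>2)" "(cmod (fourier (l2_of_h1 u) k))\<^sup>2"]
    by (cases "k = 0") (simp_all add: sobolev_term_1)
  also have "\<dots> = sum (sobolev_term 1 (l2_of_h1 u)) {k}" by simp
  also have "\<dots> \<le> (norm u)\<^sup>2"
    by (rule finite_sum_le_has_sum[OF h1_norm_has_sum]) (auto simp: sobolev_term_nonneg)
  finally show ?thesis by (rule power2_le_imp_le) simp
qed

lemma bounded_linear_fourier_fst:
  "bounded_linear (\<lambda>x :: torus_h1 \<times> torus_l2. fourier (l2_of_h1 (fst x)) k)"
  by (rule bounded_linear_intro[where K = 1])
    (auto simp: plus_torus_h1.rep_eq fourier_add l2_of_h1_scaleR fourier_scaleR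
      intro: order_trans[OF cmod_fourier_h1_le norm_fst_le])

lemma bounded_linear_fourier_snd:
  "bounded_linear (\<lambda>x :: torus_h1 \<times> torus_l2. fourier (snd x) k)"
  by (rule bounded_linear_intro[where K = 1])
    (auto simp: fourier_add fourier_scaleR intro: order_trans[OF cmod_fourier_le norm_snd_le])

lift_definition mode_h1 :: "int \<times> int \<Rightarrow> torus_h1" is torus_mode
  by (rule torus_mode_sobolev)

definition trig_poly_h1 :: "(int \<times> int) set \<Rightarrow> (int \<times> int \<Rightarrow> complex) \<Rightarrow> torus_h1" where
  "trig_poly_h1 F c = (\<Sum>k\<in>F. c k *\<^sub>C mode_h1 k)"

lemma l2_of_trig_poly_h1: "l2_of_h1 (trig_poly_h1 F c) = trig_poly F c"
  by (simp add: trig_poly_h1_def trig_poly_def l2_of_h1_sum scaleC_torus_h1.rep_eq mode_h1.rep_eq)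

lemma trig_poly_approx:
  fixes x :: "torus_h1 \<times> torus_l2"
  assumes e: "e > 0"
  obtains F c d where "finite F" "dist (trig_poly_h1 F c, trig_poly F d) x < e"
proof -
  obtain u v where x: "x = (u, v)" by fastforce
  let ?u = "\<lambda>F. norm (u - trig_poly_h1 F (fourier (l2_of_h1 u)))"
  let ?v = "\<lambda>F. norm (v - trig_poly F (fourier v))"
  have "\<forall>\<^sub>F F in finite_subsets_at_top UNIV. ?u F < e / 2"
    using order_tendstoD(2)[OF sobolev_partial_sum_tendsto[OF l2_of_h1[of u]], of "e / 2"] e
    by (simp add: norm_torus_h1.rep_eq l2_of_h1_diff l2_of_trig_poly_h1)
  moreover have "\<forall>\<^sub>F F in finite_subsets_at_top UNIV. ?v F < e / 2"
    using order_tendstoD(2)[OF sobolev_partial_sum_tendsto[OF sobolev_0[of v]], of "e / 2"] e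
    by (simp add: sobolev_norm_0)
  moreover have "\<forall>\<^sub>F F in finite_subsets_at_top (UNIV :: (int \<times> int) set). finite F"
    by (intro eventually_finite_subsets_at_top_weakI)
  ultimately have "\<forall>\<^sub>F F in finite_subsets_at_top UNIV. ?u F < e / 2 \<and> ?v F < e / 2 \<and> finite F"
    by eventually_elim simp
  then obtain F where F: "?u F < e / 2" "?v F < e / 2" "finite F"
    using eventually_happens'[OF finite_subsets_at_top_neq_bot] by blast
  have "dist (trig_poly_h1 F (fourier (l2_of_h1 u)), trig_poly F (fourier v)) x
      = norm (u - trig_poly_h1 F (fourier (l2_of_h1 u)), v - trig_poly F (fourier v))"
    unfolding x by (subst dist_commute) (simp add: dist_norm)
  also have "\<dots> \<le> ?u F + ?v F" by (rule norm_Pair_le)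
  also have "\<dots> < e" using F by simp
  finally show ?thesis using that F(3) by blast
qed

section \<open>Groups and their generators\<close>

context
  fixes T :: "real \<Rightarrow> 'a::complex_normed_vector \<Rightarrow>\<^sub>L 'a"
  assumes T: "C0_group T"
begin

lemma C0_group_simps:
  "T 0 x = x" "T (s + t) x = T s (T t x)" "T t (c *\<^sub>C x) = c *\<^sub>C T t x"
  using T by (simp_all add: C0_group_def)

lemma generator_add:
  assumes "(x, y) \<in> generator T" "(x', y') \<in> generator T"
  shows "(x + x', y + y') \<in> generator T"
proof -
  have "((\<lambda>h. (T h x - x) /\<^sub>R h + (T h x' - x') /\<^sub>R h) \<longlongrightarrow> y + y') (at 0)"
    using assms by (intro tendsto_add) (simp_all add: generator_def)
  moreover have "(T h x - x) /\<^sub>R h + (T h x' - x') /\<^sub>R h = (T h (x + x') - (x + x')) /\<^sub>R h" for h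
    by (simp add: blinfun.add_right flip: scaleR_add_right)
  ultimately show ?thesis by (simp add: generator_def)
qed

lemma generator_scaleC: "(x, y) \<in> generator T \<Longrightarrow> (c *\<^sub>C x, c *\<^sub>C y) \<in> generator T"
proof -
  interpret c: bounded_linear "\<lambda>x::'a. c *\<^sub>C x" by (rule bounded_linear_scaleC)
  assume "(x, y) \<in> generator T"
  then have "((\<lambda>h. (T h x - x) /\<^sub>R h) \<longlongrightarrow> y) (at 0)" by (simp add: generator_def)
  from c.tendsto[OF this] show ?thesis
    by (simp add: generator_def C0_group_simps c.scaleR c.diff)
qed

lemma generator_sum:
  "finite F \<Longrightarrow> (\<And>k. k \<in> F \<Longrightarrow> (x k, y k) \<in> generator T) \<Longrightarrow> (sum x F, sum y F) \<in> generator T"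
proof (induction F rule: finite_induct)
  case empty
  then show ?case by (simp add: generator_def)
next
  case (insert k F)
  then have "(x k + sum x F, y k + sum y F) \<in> generator T"
    by (intro generator_add) auto
  with insert.hyps show ?case by simp
qed

lemma generator_invariant:
  assumes "(x, y) \<in> generator T"
  shows "(T t x, T t y) \<in> generator T"
proof -
  have "((\<lambda>h. (T h x - x) /\<^sub>R h) \<longlongrightarrow> y) (at 0)" using assms by (simp add: generator_def)
  then have "((\<lambda>h. T t ((T h x - x) /\<^sub>R h)) \<longlongrightarrow> T t y) (at 0)"
    by (rule blinfun.tendsto[OF tendsto_const])
  moreover have "T t ((T h x - x) /\<^sub>R h) = (T h (T t x) - T t x) /\<^sub>R h" for h
    using C0_group_simps(2)[of t h x] C0_group_simps(2)[of h t x]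
    by (simp add: blinfun.scaleR_right blinfun.diff_right add.commute)
  ultimately show ?thesis by (simp add: generator_def)
qed

lemma group_has_vector_derivative:
  assumes "(x, y) \<in> generator T"
  shows "((\<lambda>s. T s x) has_vector_derivative T s y) (at s)"
proof -
  have "((\<lambda>h. (T h (T s x) - T s x) /\<^sub>R h) \<longlongrightarrow> T s y) (at 0)"
    using generator_invariant[OF assms, of s] by (simp add: generator_def)
  then have lim: "((\<lambda>h. norm ((T h (T s x) - T s x) /\<^sub>R h - T s y)) \<longlongrightarrow> 0) (at 0)"
    by (intro tendsto_norm_zero LIM_zero)
  have eq: "norm ((T h (T s x) - T s x) /\<^sub>R h - T s y)
      = norm (T (s + h) x - T s x - h *\<^sub>R T s y) / norm h" if "h \<noteq> 0" for h
  proof -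
    have "(T h (T s x) - T s x) /\<^sub>R h - T s y = (T (s + h) x - T s x - h *\<^sub>R T s y) /\<^sub>R h"
      using that C0_group_simps(2)[of h s x] by (simp add: scaleR_diff_right add.commute)
    then show ?thesis by (simp add: divide_inverse mult.commute)
  qed
  have "\<forall>\<^sub>F h in at 0. norm ((T h (T s x) - T s x) /\<^sub>R h - T s y)
      = norm (T (s + h) x - T s x - h *\<^sub>R T s y) / norm h"
    unfolding eventually_at_filter using eq by (intro always_eventually) blast
  with lim have "((\<lambda>h. norm (T (s + h) x - T s x - h *\<^sub>R T s y) / norm h) \<longlongrightarrow> 0) (at 0)"
    by (rule Lim_transform_eventually)
  then show ?thesis
    by (simp add: has_vector_derivative_def has_derivative_at bounded_linear_scaleR_left)
qed

end

section \<open>A Gronwall inequality for suprema\<close>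

text \<open>The function \<open>E\<close> need not be known to be differentiable: each \<open>e i\<close> stays below
  \<open>E 0\<close> plus the integral of \<open>E\<close>, hence so does their supremum \<open>E\<close>.\<close>

lemma gronwall_sup_forward:
  fixes e e' :: "'i \<Rightarrow> real \<Rightarrow> real" and E :: "real \<Rightarrow> real"
  assumes E: "continuous_on UNIV E"
    and d: "\<And>i s. i \<in> I \<Longrightarrow> (e i has_real_derivative e' i s) (at s)"
    and d_le: "\<And>i s. i \<in> I \<Longrightarrow> e' i s \<le> E s"
    and le: "\<And>i s. i \<in> I \<Longrightarrow> e i s \<le> E s"
    and sup: "\<And>s c. (\<And>i. i \<in> I \<Longrightarrow> e i s \<le> c) \<Longrightarrow> E s \<le> c"
    and t: "t \<ge> 0"
  shows "E t \<le> exp t * E 0"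
proof -
  \<comment> \<open>the margins turn the one-sided derivatives at \<open>0\<close> and \<open>t\<close> into two-sided ones\<close>
  obtain g where g: "\<And>s. s \<in> {-1..t + 1} \<Longrightarrow> (g has_vector_derivative E s) (at s within {-1..t + 1})"
    using antiderivative_continuous[OF continuous_on_subset[OF E subset_UNIV]] by blast
  have g': "(g has_real_derivative E s) (at s)" if "0 \<le> s" "s \<le> t" for s
    using g[of s] that at_within_Icc_at[of "-1" s "t + 1"]
    by (simp add: has_real_derivative_iff_has_vector_derivative)
  define \<phi> where "\<phi> s = E 0 + (g s - g 0)" for s
  have E\<phi>: "E s \<le> \<phi> s" if s: "0 \<le> s" "s \<le> t" for s
  proof (rule sup)
    fix i assume i: "i \<in> I"
    have "e i s - g s \<le> e i 0 - g 0"
    proof (rule DERIV_nonpos_imp_nonincreasing[OF s(1)])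
      fix r assume "0 \<le> r" "r \<le> s"
      then have "((\<lambda>s. e i s - g s) has_real_derivative e' i r - E r) (at r)"
        using s by (intro DERIV_diff d i g') auto
      then show "\<exists>y. ((\<lambda>s. e i s - g s) has_real_derivative y) (at r) \<and> y \<le> 0"
        using d_le[OF i, of r] by (intro exI conjI) auto
    qed
    with le[OF i, of 0] show "e i s \<le> \<phi> s" by (simp add: \<phi>_def)
  qed
  have "exp (- t) * \<phi> t \<le> exp (- 0) * \<phi> 0"
  proof (rule DERIV_nonpos_imp_nonincreasing[OF t])
    fix s assume s: "0 \<le> s" "s \<le> t"
    have "((\<lambda>s. exp (- s) * \<phi> s) has_real_derivative exp (- s) * (E s - \<phi> s)) (at s)"
      unfolding \<phi>_def by (auto intro!: derivative_eq_intros g' s simp: algebra_simps)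
    moreover have "exp (- s) * (E s - \<phi> s) \<le> 0"
      using E\<phi>[OF s] by (simp add: mult_le_0_iff)
    ultimately show "\<exists>y. ((\<lambda>s. exp (- s) * \<phi> s) has_real_derivative y) (at s) \<and> y \<le> 0" by blast
  qed
  then have "\<phi> t \<le> exp t * E 0"
    by (simp add: \<phi>_def exp_minus field_simps)
  with E\<phi>[of t] t show ?thesis by simp
qed

lemma gronwall_sup:
  fixes e e' :: "'i \<Rightarrow> real \<Rightarrow> real" and E :: "real \<Rightarrow> real"
  assumes E: "continuous_on UNIV E"
    and d: "\<And>i s. i \<in> I \<Longrightarrow> (e i has_real_derivative e' i s) (at s)"
    and d_le: "\<And>i s. i \<in> I \<Longrightarrow> \<bar>e' i s\<bar> \<le> E s"
    and le: "\<And>i s. i \<in> I \<Longrightarrow> e i s \<le> E s"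
    and sup: "\<And>s c. (\<And>i. i \<in> I \<Longrightarrow> e i s \<le> c) \<Longrightarrow> E s \<le> c"
  shows "E t \<le> exp \<bar>t\<bar> * E 0"
proof (cases "t \<ge> 0")
  case True
  have "e' i s \<le> E s" if "i \<in> I" for i s using d_le[OF that, of s] by linarith
  have "E t \<le> exp t * E 0"
    by (rule gronwall_sup_forward[where e = e and e' = e' and I = I])
      (fact E d \<open>\<And>i s. i \<in> I \<Longrightarrow> e' i s \<le> E s\<close> le sup True)+
  with True show ?thesis by simp
next
  case False
  have "E (- (- t)) \<le> exp (- t) * E (- 0)"
  proof (rule gronwall_sup_forward[where E = "\<lambda>s. E (- s)" and e = "\<lambda>i s. e i (- s)"
        and e' = "\<lambda>i s. - e' i (- s)" and I = I])
    show "continuous_on UNIV (\<lambda>s. E (- s))"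
      by (rule continuous_on_compose2[OF E]) (auto intro: continuous_intros)
    show "((\<lambda>s. e i (- s)) has_real_derivative - e' i (- s)) (at s)" if "i \<in> I" for i s
      using DERIV_mirror[of "e i" "e' i (- s)" s] d[OF that] by simp
    show "- e' i (- s) \<le> E (- s)" if "i \<in> I" for i s
      using d_le[OF that, of "- s"] by linarith
    show "e i (- s) \<le> E (- s)" if "i \<in> I" for i s by (rule le[OF that])
    show "E (- s) \<le> c" if "\<And>i. i \<in> I \<Longrightarrow> e i (- s) \<le> c" for s c by (rule sup[OF that])
    show "- t \<ge> 0" using False by simp
  qed
  with False show ?thesis by simp
qed

section \<open>The wave operator on Fourier modes\<close>

abbreviation sqlen :: "int \<times> int \<Rightarrow> real" where
  "sqlen k \<equiv> of_int ((fst k)\<^sup>2 + (snd k)\<^sup>2)"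

lemma wave_op_modes:
  assumes "(x, y) \<in> wave_op"
  shows "fourier (l2_of_h1 (fst y)) k = - fourier (snd x) k"
    and "fourier (snd y) k = of_real (sqlen k) * fourier (l2_of_h1 (fst x)) k
      - \<i> * of_int (fst k) * fourier (l2_of_h1 (fst x)) (k - (0, 1))"
proof -
  obtain u v w g where *: "x = (u, l2_of_h1 v)" "y = (- v, - w - mult_exp_iy g)"
    "weak_laplacian (l2_of_h1 u) w" "weak_dx (l2_of_h1 u) g"
    using assms by (auto simp: wave_op_def)
  show "fourier (l2_of_h1 (fst y)) k = - fourier (snd x) k"
    by (simp add: * l2_of_h1_minus fourier_minus)
  show "fourier (snd y) k = of_real (sqlen k) * fourier (l2_of_h1 (fst x)) k
      - \<i> * of_int (fst k) * fourier (l2_of_h1 (fst x)) (k - (0, 1))"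
    by (simp add: *(1,2) fourier_diff fourier_minus fourier_mult_exp_iy fourier_weak_laplacian[OF *(3)]
        fourier_weak_dx[OF *(4)] algebra_simps)
qed

lemma wave_op_mode_fst:
  "((mode_h1 k, 0), (0, of_real (sqlen k) *\<^sub>C torus_mode k
      + (- \<i> * of_int (fst k)) *\<^sub>C torus_mode (k + (0, 1)))) \<in> wave_op"
proof -
  have "((mode_h1 k, l2_of_h1 0), (- 0, - (- of_int ((fst k)\<^sup>2 + (snd k)\<^sup>2) *\<^sub>C torus_mode k)
      - mult_exp_iy ((\<i> * of_int (fst k)) *\<^sub>C torus_mode k))) \<in> wave_op"
    using torus_mode_sobolev[of k 2] weak_laplacian_torus_mode[of k] weak_dx_torus_mode[of k]
    unfolding wave_op_def mode_h1.rep_eq[symmetric] by blast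
  then show ?thesis
    by (simp only: zero_torus_h1.rep_eq mult_exp_iy_scaleC mult_exp_iy_torus_mode
        scaleC_minus_left[symmetric] diff_conv_add_uminus minus_minus mult_minus_left minus_zero
        of_real_of_int_eq)
qed

lemma wave_op_mode_snd: "((0, torus_mode k), (- mode_h1 k, 0)) \<in> wave_op"
proof -
  have z: "l2_of_h1 0 = 0" by (rule zero_torus_h1.rep_eq)
  have "weak_laplacian 0 0" "weak_dx 0 0" by (transfer, simp)+
  moreover have "mult_exp_iy 0 = 0" by transfer (simp add: sq_integrable_zero)
  ultimately have "((0, l2_of_h1 (mode_h1 k)), (- mode_h1 k, - 0 - mult_exp_iy 0)) \<in> wave_op"
    unfolding wave_op_def mem_Collect_eq using z sobolev_zero[of 2]
    by (intro exI[of _ "0 :: torus_h1"] exI[of _ "mode_h1 k"] exI[of _ "0 :: torus_l2"]) simp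
  then show ?thesis by (simp add: mode_h1.rep_eq \<open>mult_exp_iy 0 = 0\<close>)
qed

section \<open>Energy estimate\<close>

text \<open>Removing the zero mode of the first component turns the \<open>H\<^sup>1\<close> norm into the norm of the
  gradient, so this is twice the physical energy.\<close>

definition energy :: "torus_h1 \<times> torus_l2 \<Rightarrow> real" where
  "energy x = (norm x)\<^sup>2 - (cmod (fourier (l2_of_h1 (fst x)) 0))\<^sup>2"

definition mode_energy :: "torus_h1 \<times> torus_l2 \<Rightarrow> int \<times> int \<Rightarrow> real" where
  "mode_energy x k = (cmod (fourier (snd x) k))\<^sup>2 + sqlen k * (cmod (fourier (l2_of_h1 (fst x)) k))\<^sup>2"

lemma mode_energy_nonneg: "mode_energy x k \<ge> 0"
  unfolding mode_energy_def by (intro add_nonneg_nonneg mult_nonneg_nonneg) auto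

lemma mode_energy_has_sum: "(mode_energy x has_sum energy x) UNIV"
proof -
  let ?u = "l2_of_h1 (fst x)"
  let ?z = "\<lambda>k. if k = 0 then (cmod (fourier ?u 0))\<^sup>2 else 0"
  have "(?z has_sum sum ?z {0}) UNIV"
    by (rule has_sum_finite_neutralI[where B = "{0}"]) auto
  then have z: "((\<lambda>k. - ?z k) has_sum - (cmod (fourier ?u 0))\<^sup>2) UNIV"
    by (subst has_sum_uminus) simp
  have "((\<lambda>k. (cmod (fourier (snd x) k))\<^sup>2 + (sobolev_term 1 ?u k + - ?z k))
      has_sum (norm (snd x))\<^sup>2 + ((norm (fst x))\<^sup>2 + - (cmod (fourier ?u 0))\<^sup>2)) UNIV"
    by (intro has_sum_add parseval h1_norm_has_sum z)
  moreover have "(cmod (fourier (snd x) k))\<^sup>2 + (sobolev_term 1 ?u k + - ?z k) = mode_energy x k" for k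
    by (simp add: mode_energy_def sobolev_term_1)
  moreover have "(norm (snd x))\<^sup>2 + ((norm (fst x))\<^sup>2 + - (cmod (fourier ?u 0))\<^sup>2) = energy x"
    by (simp add: energy_def norm_prod_def)
  ultimately show ?thesis by simp
qed

lemma sum_mode_energy_le: "finite F \<Longrightarrow> sum (mode_energy x) F \<le> energy x"
  by (rule finite_sum_le_has_sum[OF mode_energy_has_sum]) (auto simp: mode_energy_nonneg)

context
  fixes T :: "real \<Rightarrow> (torus_h1 \<times> torus_l2) \<Rightarrow>\<^sub>L (torus_h1 \<times> torus_l2)"
  assumes T: "C0_group T"
    and gen: "generator T = {(x, - y) | x y. (x, y) \<in> wave_op}"
begin

text \<open>This gives density of the domain as well as the explicit values on the approximate
  eigenvectors below.\<close>

lemma generator_trig_poly: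
  assumes F: "finite F"
  shows "((trig_poly_h1 F c, trig_poly F d), (trig_poly_h1 F d,
    (\<Sum>k\<in>F. c k *\<^sub>C ((- of_real (sqlen k)) *\<^sub>C torus_mode k
      + (\<i> * of_int (fst k)) *\<^sub>C torus_mode (k + (0, 1)))))) \<in> generator T"
proof -
  let ?r = "\<lambda>k. (- of_real (sqlen k)) *\<^sub>C torus_mode k + (\<i> * of_int (fst k)) *\<^sub>C torus_mode (k + (0, 1))"
  have 1: "((mode_h1 k, 0), (0, ?r k)) \<in> generator T" for k
  proof -
    have "((mode_h1 k, 0), - (0, of_real (sqlen k) *\<^sub>C torus_mode k
      + (- \<i> * of_int (fst k)) *\<^sub>C torus_mode (k + (0, 1)))) \<in> generator T"
      unfolding gen using wave_op_mode_fst[of k] by blast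
    moreover have "- (0, of_real (sqlen k) *\<^sub>C torus_mode k
      + (- \<i> * of_int (fst k)) *\<^sub>C torus_mode (k + (0, 1))) = (0 :: torus_h1, ?r k)"
      by (simp add: scaleC_minus_left del: of_int_add)
    ultimately show ?thesis by simp
  qed
  have 2: "((0, torus_mode k), (mode_h1 k, 0)) \<in> generator T" for k
  proof -
    have "((0, torus_mode k), - (- mode_h1 k, 0)) \<in> generator T"
      unfolding gen using wave_op_mode_snd[of k] by blast
    then show ?thesis by simp
  qed
  have "((\<Sum>k\<in>F. c k *\<^sub>C (mode_h1 k, 0)) + (\<Sum>k\<in>F. d k *\<^sub>C (0, torus_mode k)),
      (\<Sum>k\<in>F. c k *\<^sub>C (0, ?r k)) + (\<Sum>k\<in>F. d k *\<^sub>C (mode_h1 k, 0))) \<in> generator T"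
    by (intro generator_add[OF T] generator_sum[OF T F] generator_scaleC[OF T] 1 2)
  then show ?thesis
    unfolding sum_scaleC_Pair by (simp add: scaleC_zero trig_poly_h1_def trig_poly_def)
qed

lemma generator_modes:
  assumes "(x, y) \<in> generator T"
  shows "fourier (l2_of_h1 (fst y)) k = fourier (snd x) k"
    and "fourier (snd y) k = - of_real (sqlen k) * fourier (l2_of_h1 (fst x)) k
      + \<i> * of_int (fst k) * fourier (l2_of_h1 (fst x)) (k - (0, 1))"
proof -
  have w: "(x, - y) \<in> wave_op" using assms unfolding gen by auto
  show "fourier (l2_of_h1 (fst y)) k = fourier (snd x) k"
    using wave_op_modes(1)[OF w, of k] by (simp add: l2_of_h1_minus fourier_minus)
  have "- fourier (snd y) k = of_real (sqlen k) * fourier (l2_of_h1 (fst x)) k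
      - \<i> * of_int (fst k) * fourier (l2_of_h1 (fst x)) (k - (0, 1))"
    using wave_op_modes(2)[OF w, of k] by (simp add: fourier_minus)
  from arg_cong[OF this, of uminus]
  show "fourier (snd y) k = - of_real (sqlen k) * fourier (l2_of_h1 (fst x)) k
      + \<i> * of_int (fst k) * fourier (l2_of_h1 (fst x)) (k - (0, 1))"
    by (simp add: algebra_simps)
qed

lemma modes_have_derivative:
  assumes "(x, y) \<in> generator T"
  shows "((\<lambda>s. fourier (l2_of_h1 (fst (T s x))) k) has_vector_derivative fourier (snd (T s x)) k) (at s)"
    and "((\<lambda>s. fourier (snd (T s x)) k) has_vector_derivative
      - of_real (sqlen k) * fourier (l2_of_h1 (fst (T s x))) k
      + \<i> * of_int (fst k) * fourier (l2_of_h1 (fst (T s x))) (k - (0, 1))) (at s)"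
  using bounded_linear.has_vector_derivative[OF bounded_linear_fourier_fst group_has_vector_derivative[OF T assms], of k s]
    bounded_linear.has_vector_derivative[OF bounded_linear_fourier_snd group_has_vector_derivative[OF T assms], of k s]
  by (simp_all only: generator_modes[OF generator_invariant[OF T assms]])

text \<open>No nonempty finite index set is invariant under the coupling of \<open>k\<close> with \<open>k - (0, 1)\<close>, so the derivative of a
  finite partial sum is estimated by the full energy and not by the same partial sum.\<close>

lemma energy_growth:
  assumes xy: "(x, y) \<in> generator T"
  shows "energy (T t x) \<le> exp \<bar>t\<bar> * energy x"
proof -
  define a where "a k s = fourier (l2_of_h1 (fst (T s x))) k" for k s
  define b where "b k s = fourier (snd (T s x)) k" for k s
  define e' where "e' F s = (\<Sum>k\<in>F. 2 * (b k s \<bullet> (\<i> * of_int (fst k) * a (k - (0, 1)) s)))" for F s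
  have da: "(a k has_vector_derivative b k s) (at s)"
    and db: "(b k has_vector_derivative - of_real (sqlen k) * a k s + \<i> * of_int (fst k) * a (k - (0, 1)) s) (at s)" for k s
    unfolding a_def b_def by (rule modes_have_derivative[OF xy])+
  have sq: "((\<lambda>s. (cmod (f s))\<^sup>2) has_real_derivative 2 * (f s \<bullet> f')) (at s)"
    if "(f has_vector_derivative f') (at s)" for f f' s
    using bounded_bilinear.has_vector_derivative[OF bounded_bilinear_inner that that]
    by (simp add: has_real_derivative_iff_has_vector_derivative power2_norm_eq_inner inner_commute)
  have me: "mode_energy (T s x) k = (cmod (b k s))\<^sup>2 + sqlen k * (cmod (a k s))\<^sup>2" for s k
    by (simp add: mode_energy_def a_def b_def)
  have cont: "continuous_on UNIV (\<lambda>s. energy (T s x))"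
  proof -
    have c: "continuous_on UNIV (\<lambda>s. T s x)" using T unfolding C0_group_def by blast
    show ?thesis
      unfolding energy_def
      by (intro continuous_intros c bounded_linear.continuous_on[OF bounded_linear_fourier_fst])
  qed
  have "energy (T t x) \<le> exp \<bar>t\<bar> * energy (T 0 x)"
  proof (rule gronwall_sup[where e = "\<lambda>F s. sum (mode_energy (T s x)) F" and e' = e'
        and I = "{F. finite F}" and E = "\<lambda>s. energy (T s x)"])
    show "continuous_on UNIV (\<lambda>s. energy (T s x))" by (rule cont)
    show "sum (mode_energy (T s x)) F \<le> energy (T s x)" if "F \<in> {F. finite F}" for F s
      using that by (intro sum_mode_energy_le) simp
    show "energy (T s x) \<le> c" if "\<And>F. F \<in> {F. finite F} \<Longrightarrow> sum (mode_energy (T s x)) F \<le> c" for s c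
      by (rule has_sum_le_finite_sums[OF mode_energy_has_sum]) (use that in auto)
    show "((\<lambda>s. sum (mode_energy (T s x)) F) has_real_derivative e' F s) (at s)" if "F \<in> {F. finite F}" for F s
      unfolding e'_def me
    proof (rule DERIV_sum)
      fix k
      have "((\<lambda>s. (cmod (b k s))\<^sup>2 + sqlen k * (cmod (a k s))\<^sup>2) has_real_derivative
          2 * (b k s \<bullet> (- of_real (sqlen k) * a k s + \<i> * of_int (fst k) * a (k - (0, 1)) s))
          + sqlen k * (2 * (a k s \<bullet> b k s))) (at s)"
        by (intro DERIV_add DERIV_cmult sq da db)
      \<comment> \<open>the Laplacian cancels against the derivative of the potential energy\<close>
      moreover have "b k s \<bullet> (- of_real (sqlen k) * a k s) = - sqlen k * (a k s \<bullet> b k s)"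
        by (simp only: of_real_minus[symmetric] scaleR_conv_of_real[symmetric] inner_scaleR_right inner_commute)
      ultimately show "((\<lambda>s. (cmod (b k s))\<^sup>2 + sqlen k * (cmod (a k s))\<^sup>2) has_real_derivative
          2 * (b k s \<bullet> (\<i> * of_int (fst k) * a (k - (0, 1)) s))) (at s)"
        by (simp only: inner_add_right) (simp add: algebra_simps)
    qed
    show "\<bar>e' F s\<bar> \<le> energy (T s x)" if "F \<in> {F. finite F}" for F s
    proof -
      have F: "finite F" using that by simp
      let ?A = "\<lambda>k. sqlen k * (cmod (a k s))\<^sup>2" and ?B = "\<lambda>k. (cmod (b k s))\<^sup>2"
      let ?sh = "\<lambda>k::int \<times> int. k - (0, 1)"
      let ?G = "F \<union> ?sh ` F"
      have A0: "?A k \<ge> 0" for k by (intro mult_nonneg_nonneg) auto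
      have 1: "\<bar>2 * (b k s \<bullet> (\<i> * of_int (fst k) * a (?sh k) s))\<bar> \<le> ?B k + ?A (?sh k)" for k
      proof -
        let ?z = "\<i> * of_int (fst k) * a (?sh k) s"
        have "\<bar>2 * (b k s \<bullet> ?z)\<bar> \<le> 2 * (cmod (b k s) * cmod ?z)"
          using Cauchy_Schwarz_ineq2[of "b k s" ?z] by simp
        also have "\<dots> \<le> ?B k + (cmod ?z)\<^sup>2"
          using sum_squares_bound[of "cmod (b k s)" "cmod ?z"] by simp
        also have "(cmod ?z)\<^sup>2 = (of_int (fst k))\<^sup>2 * (cmod (a (?sh k) s))\<^sup>2"
          by (simp add: norm_mult power_mult_distrib)
        \<comment> \<open>the shift leaves the first frequency alone, so the factor \<open>fst k\<close> is controlled by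
          the gradient of the neighbouring mode\<close>
        also have "\<dots> \<le> ?A (?sh k)"
          by (intro mult_right_mono) auto
        finally show ?thesis by simp
      qed
      have "\<bar>e' F s\<bar> \<le> (\<Sum>k\<in>F. ?B k + ?A (?sh k))"
        unfolding e'_def by (rule order_trans[OF sum_abs sum_mono[OF 1]])
      also have "\<dots> = sum ?B F + sum ?A (?sh ` F)"
        by (simp add: sum.distrib sum.reindex inj_on_def)
      also have "\<dots> \<le> sum ?B ?G + sum ?A ?G"
        using F A0 by (intro add_mono sum_mono2) auto
      also have "\<dots> = sum (mode_energy (T s x)) ?G"
        unfolding me by (simp only: sum.distrib)
      also have "\<dots> \<le> energy (T s x)"
        using F by (intro sum_mode_energy_le) auto
      finally show ?thesis .
    qed
  qed
  then show ?thesis by (simp add: C0_group_simps[OF T])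
qed

text \<open>The factor \<open>fst k\<close> in the coupling vanishes at \<open>k = 0\<close>, so that the second component is
  constant there and the first one is affine.\<close>

lemma zero_mode_growth:
  assumes xy: "(x, y) \<in> generator T"
  shows "cmod (fourier (l2_of_h1 (fst (T t x))) 0) \<le> (1 + \<bar>t\<bar>) * norm x"
proof -
  define a where "a s = fourier (l2_of_h1 (fst (T s x))) 0" for s
  define b where "b s = fourier (snd (T s x)) 0" for s
  have "(b has_vector_derivative 0) (at s)" for s
    using modes_have_derivative(2)[OF xy, of 0 s] by (simp add: b_def[abs_def])
  then obtain c where c: "\<And>s. b s = c"
    using has_vector_derivative_zero_constant[of UNIV b] by auto
  have "((\<lambda>s. a s - s *\<^sub>R c) has_vector_derivative 0) (at s)" for s
    using modes_have_derivative(1)[OF xy, of 0 s] c[of s]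
    by (auto intro!: derivative_eq_intros simp: a_def[abs_def] b_def)
  then obtain d where d: "\<And>s. a s - s *\<^sub>R c = d"
    using has_vector_derivative_zero_constant[of UNIV "\<lambda>s. a s - s *\<^sub>R c"] by auto
  have "a t = a 0 + t *\<^sub>R b 0" using d[of t] d[of 0] c[of 0] by (simp add: algebra_simps)
  then have "cmod (a t) \<le> cmod (a 0) + \<bar>t\<bar> * cmod (b 0)"
    using norm_triangle_ineq[of "a 0" "t *\<^sub>R b 0"] by simp
  also have "\<dots> \<le> norm x + \<bar>t\<bar> * norm x"
  proof (intro add_mono mult_left_mono)
    show "cmod (a 0) \<le> norm x"
      using order_trans[OF cmod_fourier_h1_le norm_fst_le[of "fst x" "snd x"]]
      by (simp add: a_def C0_group_simps[OF T])
    show "cmod (b 0) \<le> norm x"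
      using order_trans[OF cmod_fourier_le norm_snd_le[of "snd x" "fst x"]]
      by (simp add: b_def C0_group_simps[OF T])
  qed simp
  finally show ?thesis unfolding a_def by (simp add: algebra_simps)
qed

lemma norm_group_generator_le:
  assumes xy: "(x, y) \<in> generator T"
  shows "norm (T t x) \<le> 2 * (1 + \<bar>t\<bar>) * exp (\<bar>t\<bar> / 2) * norm x"
proof -
  define r where "r = (1 + \<bar>t\<bar>) * exp (\<bar>t\<bar> / 2)"
  have e: "exp \<bar>t\<bar> = (exp (\<bar>t\<bar> / 2))\<^sup>2" by (simp add: power2_eq_square flip: exp_add)
  have r1: "exp (\<bar>t\<bar> / 2) \<le> r" "1 + \<bar>t\<bar> \<le> r" "r \<ge> 0"
    unfolding r_def using mult_right_mono[of 1 "1 + \<bar>t\<bar>" "exp (\<bar>t\<bar> / 2)"]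
      mult_left_mono[of 1 "exp (\<bar>t\<bar> / 2)" "1 + \<bar>t\<bar>"] by auto
  have ex: "energy x \<le> (norm x)\<^sup>2" by (simp add: energy_def)
  have "(norm (T t x))\<^sup>2 = energy (T t x) + (cmod (fourier (l2_of_h1 (fst (T t x))) 0))\<^sup>2"
    by (simp add: energy_def)
  also have "\<dots> \<le> exp \<bar>t\<bar> * (norm x)\<^sup>2 + ((1 + \<bar>t\<bar>) * norm x)\<^sup>2"
    by (intro add_mono order_trans[OF energy_growth[OF xy]] mult_left_mono ex power_mono
        zero_mode_growth[OF xy]) auto
  also have "\<dots> \<le> (r * norm x)\<^sup>2 + (r * norm x)\<^sup>2"
    unfolding e power_mult_distrib
    by (intro add_mono mult_right_mono power_mono r1) auto
  also have "\<dots> \<le> (2 * r * norm x)\<^sup>2" by (simp add: power_mult_distrib)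
  finally have "norm (T t x) \<le> 2 * r * norm x"
    by (rule power2_le_imp_le) (use r1 in simp)
  then show ?thesis unfolding r_def mult.assoc .
qed

lemma norm_group_le: "norm (T t) \<le> 2 * (1 + \<bar>t\<bar>) * exp (\<bar>t\<bar> / 2)"
proof (rule norm_blinfun_bound)
  let ?C = "2 * (1 + \<bar>t\<bar>) * exp (\<bar>t\<bar> / 2)"
  let ?D = "{x. norm (T t x) \<le> ?C * norm x}"
  have cl: "closed ?D" by (intro closed_Collect_le continuous_intros)
  fix x
  have "x \<in> closure ?D"
    unfolding closure_approachable
  proof (intro allI impI)
    fix e :: real assume "e > 0"
    then obtain F c d where F: "finite F" "dist (trig_poly_h1 F c, trig_poly F d) x < e"
      by (rule trig_poly_approx)
    have "(trig_poly_h1 F c, trig_poly F d) \<in> ?D"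
      using norm_group_generator_le[OF generator_trig_poly[OF F(1)]] by simp
    with F(2) show "\<exists>y\<in>?D. dist y x < e" by blast
  qed
  then show "norm (T t x) \<le> ?C * norm x" using cl by (simp add: closure_closed)
qed simp

section \<open>Approximate eigenvectors\<close>

text \<open>The first component is \<open>e\<^bsup>imx\<^esup>\<close> times the Dirichlet kernel of length \<open>N\<close> centred at \<open>y = 0\<close> for
  \<open>\<sigma> = 1\<close> and at \<open>y = \<pi>\<close> for \<open>\<sigma> = -1\<close>.\<close>

lemma generator_quasimode:
  assumes \<sigma>: "\<sigma> = 1 \<or> \<sigma> = -1" and N: "N \<ge> 1"
  obtains x y \<mu> where "(x, y) \<in> generator T" "x \<noteq> 0" "Re \<mu> = \<sigma> / 2"
    "norm (y - \<mu> *\<^sub>C x) \<le> 3 * sqrt (inverse (real N)) * norm x"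
proof -
  \<comment> \<open>\<open>m\<close> must dominate the \<open>y\<close>-derivatives, which are of order \<open>N\<^sup>2\<close> on each of the \<open>N\<close> modes\<close>
  define m where "m = N ^ 3"
  define \<mu> where "\<mu> = Complex (\<sigma> / 2) (real m)"
  define s where "s j = (of_real \<sigma> :: complex) ^ j" for j
  define p where "p j = (int m, int j)" for j
  define F where "F = p ` {..<N}"
  define c where "c k = s (nat (snd k))" for k :: "int \<times> int"
  define u where "u = trig_poly_h1 F c"
  define x where "x = (u, trig_poly F (\<lambda>k. \<mu> * c k))"
  define w where "w = (\<Sum>k\<in>F. c k *\<^sub>C ((- of_real (sqlen k)) *\<^sub>C torus_mode k
      + (\<i> * of_int (fst k)) *\<^sub>C torus_mode (k + (0, 1))))"
  define y where "y = (trig_poly_h1 F (\<lambda>k. \<mu> * c k), w)"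
  define D where "D j = s j *\<^sub>C torus_mode (p j)" for j
  have F: "finite F" by (simp add: F_def)
  have inj: "inj_on p A" for A by (simp add: p_def inj_on_def)
  have \<sigma>2: "\<sigma> * \<sigma> = 1" and s1: "cmod (s j) = 1" for j using \<sigma> by (auto simp: s_def norm_power)
  have cp: "c (p j) = s j" for j by (simp add: c_def p_def)
  have xy: "(x, y) \<in> generator T"
    unfolding x_def y_def u_def w_def by (rule generator_trig_poly[OF F])
  have D1: "norm (D j) = 1" for j by (simp add: D_def norm_scaleC s1 norm_torus_mode)
  have \<mu>2: "\<mu> * \<mu> = - (real m)\<^sup>2 + 1 / 4 + \<i> * real m * \<sigma>"
    using \<sigma>2 by (simp add: \<mu>_def complex_eq_iff power2_eq_square)
  have scaleC_combine_left: "s *\<^sub>C (a *\<^sub>C e + b *\<^sub>C e') - \<mu> *\<^sub>C r *\<^sub>C e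
      = (s * a - \<mu> * r) *\<^sub>C e + (s * b) *\<^sub>C e'" for s a b r and e e' :: torus_l2
    by (simp add: scaleC_add_right scaleC_scaleC scaleC_diff_left)
  have scaleC_combine_right: "g *\<^sub>C e + z *\<^sub>C (b *\<^sub>C e' - a *\<^sub>C e)
      = (g - z * a) *\<^sub>C e + (z * b) *\<^sub>C e'" for g z a b and e e' :: torus_l2
    by (simp add: scaleC_diff_right scaleC_scaleC scaleC_diff_left)
  \<comment> \<open>The Laplacian and \<open>\<mu>\<^sup>2\<close> both contribute \<open>-m\<^sup>2\<close>, which cancels in the difference. The terms of order \<open>m\<close> combine to a
    difference of consecutive \<open>D\<close>, because \<open>\<sigma>\<^sup>2 = 1\<close>.\<close>
  have summand: "s j *\<^sub>C ((- of_real (sqlen (p j))) *\<^sub>C torus_mode (p j)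
      + (\<i> * of_int (fst (p j))) *\<^sub>C torus_mode (p j + (0, 1))) - \<mu> *\<^sub>C (\<mu> * s j) *\<^sub>C torus_mode (p j)
    = (- ((real j)\<^sup>2 + 1 / 4) * s j) *\<^sub>C torus_mode (p j)
      + (\<i> * real m * \<sigma>) *\<^sub>C (D (Suc j) - D j)" for j
  proof -
    have 1: "p j + (0, 1) = p (Suc j)" by (simp add: p_def)
    have 2: "s j * (\<i> * of_int (fst (p j))) = \<i> * real m * \<sigma> * s (Suc j)"
    proof -
      have "complex_of_real \<sigma> * of_real \<sigma> = 1" using \<sigma>2 by (metis of_real_1 of_real_mult)
      then show ?thesis by (simp add: p_def s_def)
    qed
    have 3: "s j * (- of_real (sqlen (p j))) - \<mu> * (\<mu> * s j)
        = - ((real j)\<^sup>2 + 1 / 4) * s j - \<i> * real m * \<sigma> * s j"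
      unfolding mult.assoc[symmetric] \<mu>2 by (simp add: p_def algebra_simps)
    show ?thesis
      unfolding D_def scaleC_combine_left scaleC_combine_right 1 2 3 ..
  qed
  have "y - \<mu> *\<^sub>C x = (0, w - \<mu> *\<^sub>C trig_poly F (\<lambda>k. \<mu> * c k))"
  proof -
    have "trig_poly_h1 F (\<lambda>k. \<mu> * c k) = \<mu> *\<^sub>C u"
      by (simp add: u_def trig_poly_h1_def scaleC_sum_right scaleC_scaleC)
    then show ?thesis by (simp add: x_def y_def scaleC_prod_def)
  qed
  also have "norm \<dots> = norm (w - \<mu> *\<^sub>C trig_poly F (\<lambda>k. \<mu> * c k))" by (simp add: norm_Pair)
  also have "w - \<mu> *\<^sub>C trig_poly F (\<lambda>k. \<mu> * c k)
      = (\<Sum>j<N. (- ((real j)\<^sup>2 + 1 / 4) * s j) *\<^sub>C torus_mode (p j)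
          + (\<i> * real m * \<sigma>) *\<^sub>C (D (Suc j) - D j))"
    unfolding summand[symmetric] w_def trig_poly_def F_def
    by (simp add: sum.reindex[OF inj] cp sum_subtractf scaleC_sum_right)
  also have "\<dots> = (\<Sum>j<N. (- ((real j)\<^sup>2 + 1 / 4) * s j) *\<^sub>C torus_mode (p j))
      + (\<i> * real m * \<sigma>) *\<^sub>C (D N - D 0)"
    unfolding sum.distrib scaleC_sum_right[symmetric] sum_lessThan_telescope ..
  also have "norm \<dots> \<le> (\<Sum>j<N. (real N)\<^sup>2) + real m * 2"
  proof (intro norm_triangle_le add_mono sum_norm_le)
    fix j assume "j \<in> {..<N}"
    then have "real j \<le> real N - 1" by auto
    then have "(real j)\<^sup>2 \<le> (real N - 1)\<^sup>2" by (intro power_mono) auto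
    also have "\<dots> + 1 / 4 \<le> (real N)\<^sup>2" using N by (simp add: power2_diff)
    finally have "(real j)\<^sup>2 + 1 / 4 \<le> (real N)\<^sup>2" by simp
    moreover have "cmod (- ((real j)\<^sup>2 + 1 / 4) * s j) = (real j)\<^sup>2 + 1 / 4"
    proof -
      have "cmod (- complex_of_real ((real j)\<^sup>2 + 1 / 4)) = (real j)\<^sup>2 + 1 / 4"
        by (simp only: norm_minus_cancel norm_of_real) simp
      then show ?thesis by (simp add: norm_mult s1)
    qed
    ultimately show "norm ((- ((real j)\<^sup>2 + 1 / 4) * s j) *\<^sub>C torus_mode (p j)) \<le> (real N)\<^sup>2"
      by (simp only: norm_scaleC norm_torus_mode mult_1_right)
  next
    have "norm (D N - D 0) \<le> 2" using norm_triangle_ineq4[of "D N" "D 0"] by (simp add: D1)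
    moreover have "\<bar>\<sigma>\<bar> = 1" using \<sigma> by auto
    ultimately show "norm ((\<i> * real m * \<sigma>) *\<^sub>C (D N - D 0)) \<le> real m * 2"
      by (simp add: norm_scaleC norm_mult mult_left_mono)
  qed
  also have "\<dots> = 3 * real m" by (simp add: m_def power2_eq_square power3_eq_cube)
  finally have yx: "norm (y - \<mu> *\<^sub>C x) \<le> 3 * real m" .
  have "real N * (real m)\<^sup>2 = (\<Sum>j<N. (real m)\<^sup>2)" by simp
  also have "\<dots> \<le> (\<Sum>j<N. sobolev_term 1 (l2_of_h1 u) (p j))"
  proof (rule sum_mono)
    fix j assume j: "j \<in> {..<N}"
    have "p j \<noteq> 0" using N by (simp add: p_def m_def zero_prod_def)
    then have "sobolev_term 1 (l2_of_h1 u) (p j) = sqlen (p j) * (cmod (c (p j)))\<^sup>2"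
      using j by (simp add: sobolev_term_1 u_def l2_of_trig_poly_h1 fourier_trig_poly F F_def)
    then show "(real m)\<^sup>2 \<le> sobolev_term 1 (l2_of_h1 u) (p j)"
      unfolding cp s1 by (simp add: p_def)
  qed
  also have "\<dots> = sum (sobolev_term 1 (l2_of_h1 u)) F"
    by (simp add: F_def sum.reindex[OF inj])
  also have "\<dots> \<le> (norm u)\<^sup>2"
    by (rule finite_sum_le_has_sum[OF h1_norm_has_sum]) (auto simp: F sobolev_term_nonneg)
  also have "\<dots> \<le> (norm x)\<^sup>2"
    using norm_fst_le[of u "snd x"] by (intro power_mono) (auto simp: x_def)
  finally have "sqrt (real N * (real m)\<^sup>2) \<le> norm x" by (rule real_le_lsqrt[rotated]) simp
  then have nx: "sqrt (real N) * real m \<le> norm x" by (simp add: real_sqrt_mult)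
  have m0: "real m > 0" and N0: "sqrt (real N) > 0" using N by (auto simp: m_def)
  show ?thesis
  proof (rule that[OF xy, of \<mu>])
    show "x \<noteq> 0" using nx mult_pos_pos[OF N0 m0] by auto
    show "Re \<mu> = \<sigma> / 2" by (simp add: \<mu>_def)
    have "3 * real m = 3 * sqrt (inverse (real N)) * (sqrt (real N) * real m)"
      using N0 by (simp add: real_sqrt_inverse)
    also have "\<dots> \<le> 3 * sqrt (inverse (real N)) * norm x"
      using nx by (intro mult_left_mono) auto
    finally show "norm (y - \<mu> *\<^sub>C x) \<le> 3 * sqrt (inverse (real N)) * norm x" using yx by simp
  qed
qed

text \<open>An approximate eigenvector with eigenvalue \<open>\<mu>\<close> evolves like \<open>e\<^bsup>\<mu>t\<^esup>\<close> up to an error that tends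
  to zero at each fixed time. The a priori bound on \<open>T\<close> controls this error.\<close>

lemma norm_group_ge: "exp (\<bar>t\<bar> / 2) \<le> norm (T t)"
proof -
  define \<sigma> :: real where "\<sigma> = (if t \<ge> 0 then 1 else -1)"
  have \<sigma>: "\<sigma> = 1 \<or> \<sigma> = -1" by (simp add: \<sigma>_def)
  define K where "K = 2 * (1 + \<bar>t\<bar>) * 3 * \<bar>t\<bar>"
  have bound: "1 - K * sqrt (inverse (real (Suc n))) \<le> exp (- \<bar>t\<bar> / 2) * norm (T t)" for n
  proof -
    obtain x y \<mu> where xy: "(x, y) \<in> generator T" "x \<noteq> 0" "Re \<mu> = \<sigma> / 2"
      and q: "norm (y - \<mu> *\<^sub>C x) \<le> 3 * sqrt (inverse (real (Suc n))) * norm x"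
      by (rule generator_quasimode[OF \<sigma>, of "Suc n"], simp, rule that)
    \<comment> \<open>\<open>f\<close> would be constant for an exact eigenvector; the choice of \<open>\<sigma>\<close> makes the factor
      \<open>exp (- \<mu> s)\<close> cancel the exponential growth of \<open>T s\<close> between \<open>0\<close> and \<open>t\<close>\<close>
    define f where "f s = exp (- \<mu> * of_real s) *\<^sub>C T s x" for s
    define B where "B = 2 * (1 + \<bar>t\<bar>) * (3 * sqrt (inverse (real (Suc n))) * norm x)"
    have d: "(f has_vector_derivative exp (- \<mu> * of_real s) *\<^sub>C T s (y - \<mu> *\<^sub>C x)) (at s within A)" for s A
    proof -
      have "((\<lambda>w. exp (- \<mu> * w)) has_field_derivative - \<mu> * exp (- \<mu> * of_real s)) (at (of_real s))"
        by (auto intro!: derivative_eq_intros)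
      from bounded_bilinear.has_vector_derivative[OF bounded_bilinear_scaleC
          has_vector_derivative_real_field[OF this] group_has_vector_derivative[OF T xy(1), of s]]
      have "(f has_vector_derivative exp (- \<mu> * of_real s) *\<^sub>C T s y
          + (- \<mu> * exp (- \<mu> * of_real s)) *\<^sub>C T s x) (at s)"
        by (simp add: f_def[abs_def])
      moreover have "exp (- \<mu> * of_real s) *\<^sub>C T s y + (- \<mu> * exp (- \<mu> * of_real s)) *\<^sub>C T s x
          = exp (- \<mu> * of_real s) *\<^sub>C T s (y - \<mu> *\<^sub>C x)"
        by (simp add: blinfun.diff_right C0_group_simps[OF T] scaleC_diff_right scaleC_scaleC
            scaleC_minus_left mult.commute)
      ultimately show ?thesis by (simp add: has_vector_derivative_at_within)
    qed
    have e: "cmod (exp (- \<mu> * of_real s)) = exp (- \<bar>s\<bar> / 2)" if "s \<in> closed_segment 0 t" for s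
    proof -
      have "\<sigma> * s = \<bar>s\<bar>"
        using that by (auto simp: \<sigma>_def closed_segment_eq_real_ivl split: if_splits)
      then show ?thesis by (simp add: xy(3))
    qed
    have "norm (f t - f 0) \<le> B * norm (t - 0)"
    proof (rule differentiable_bound[where S = "closed_segment 0 t" and f' = "\<lambda>s h. h *\<^sub>R (exp (- \<mu> * of_real s) *\<^sub>C T s (y - \<mu> *\<^sub>C x))"])
      show "(f has_derivative (\<lambda>h. h *\<^sub>R (exp (- \<mu> * of_real s) *\<^sub>C T s (y - \<mu> *\<^sub>C x)))) (at s within closed_segment 0 t)" for s
        using d by (simp add: has_vector_derivative_def)
      fix s assume s: "s \<in> closed_segment 0 t"
      have st: "\<bar>s\<bar> \<le> \<bar>t\<bar>" using s by (auto simp: closed_segment_eq_real_ivl split: if_splits)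
      have "norm (exp (- \<mu> * of_real s) *\<^sub>C T s (y - \<mu> *\<^sub>C x))
          \<le> exp (- \<bar>s\<bar> / 2) * (norm (T s) * norm (y - \<mu> *\<^sub>C x))"
        by (simp only: norm_scaleC e[OF s]) (intro mult_left_mono norm_blinfun, simp)
      also have "\<dots> \<le> exp (- \<bar>s\<bar> / 2) * ((2 * (1 + \<bar>s\<bar>) * exp (\<bar>s\<bar> / 2)) * (3 * sqrt (inverse (real (Suc n))) * norm x))"
        by (intro mult_left_mono mult_mono norm_group_le q) auto
      also have "\<dots> = 2 * (1 + \<bar>s\<bar>) * (3 * sqrt (inverse (real (Suc n))) * norm x)"
        by (simp add: exp_minus)
      also have "\<dots> \<le> B"
        unfolding B_def using st by (intro mult_right_mono mult_nonneg_nonneg) auto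
      finally have nB: "norm (exp (- \<mu> * of_real s) *\<^sub>C T s (y - \<mu> *\<^sub>C x)) \<le> B" .
      show "onorm (\<lambda>h. h *\<^sub>R (exp (- \<mu> * of_real s) *\<^sub>C T s (y - \<mu> *\<^sub>C x))) \<le> B"
      proof (rule onorm_bound)
        show "B \<ge> 0" using nB norm_ge_zero order_trans by blast
        show "norm (h *\<^sub>R (exp (- \<mu> * of_real s) *\<^sub>C T s (y - \<mu> *\<^sub>C x))) \<le> B * norm h" for h
          using mult_right_mono[OF nB, of "norm h"] by (simp add: mult.commute)
      qed
    qed auto
    moreover have "f 0 = x"
      by (simp add: f_def C0_group_simps[OF T] scaleC_one)
    moreover have "norm (f t) \<le> exp (- \<bar>t\<bar> / 2) * (norm (T t) * norm x)"
      unfolding f_def norm_scaleC e[OF ends_in_segment(2)]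
      by (intro mult_left_mono norm_blinfun) simp
    moreover have "norm x - norm (f t) \<le> norm (f t - x)"
      by (metis norm_minus_commute norm_triangle_ineq2)
    ultimately have "norm x - B * \<bar>t\<bar> \<le> exp (- \<bar>t\<bar> / 2) * (norm (T t) * norm x)"
      by simp
    also have "norm x - B * \<bar>t\<bar> = (1 - K * sqrt (inverse (real (Suc n)))) * norm x"
      by (simp add: B_def K_def algebra_simps)
    finally have "(1 - K * sqrt (inverse (real (Suc n)))) * norm x \<le> (exp (- \<bar>t\<bar> / 2) * norm (T t)) * norm x"
      by (simp only: mult.assoc)
    then show ?thesis using xy(2) by (simp only: mult_le_cancel_right) auto
  qed
  have "(\<lambda>n. 1 - K * sqrt (inverse (real (Suc n)))) \<longlonglongrightarrow> 1 - K * sqrt 0"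
    by (intro tendsto_intros LIMSEQ_inverse_real_of_nat)
  then have "1 \<le> exp (- \<bar>t\<bar> / 2) * norm (T t)"
    using bound by (intro LIMSEQ_le_const2[where X = "\<lambda>n. 1 - K * sqrt (inverse (real (Suc n)))"]) auto
  then show ?thesis by (simp add: exp_minus field_simps)
qed

end

section \<open>Growth bounds\<close>

text \<open>A polynomial factor does not affect the exponential rate.\<close>

lemma growth_bound_eqI:
  fixes T :: "real \<Rightarrow> 'a::complex_normed_vector \<Rightarrow>\<^sub>L 'a"
  assumes lower: "\<And>t. t \<ge> 0 \<Longrightarrow> exp (a * t) \<le> norm (T t)"
    and upper: "\<And>t. t \<ge> 0 \<Longrightarrow> norm (T t) \<le> C * (1 + t) * exp (a * t)"
  shows "growth_bound T = ereal a"
  unfolding growth_bound_def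
proof (rule antisym)
  have C: "C \<ge> 0" using order_trans[OF norm_ge_zero upper[of 0]] by simp
  let ?\<Omega> = "{\<omega>. \<exists>M\<ge>0. \<forall>t\<ge>0. norm (T t) \<le> M * exp (\<omega> * t)}"
  show "Inf (ereal ` ?\<Omega>) \<le> ereal a"
  proof (rule ereal_le_epsilon2)
    fix e :: real assume e: "e > 0"
    have "norm (T t) \<le> C * (1 + 1 / e) * exp ((a + e) * t)" if t: "t \<ge> 0" for t
    proof -
      have "1 + t \<le> (1 + 1 / e) * exp (e * t)"
      proof -
        have "e * t \<le> exp (e * t)" using exp_ge_add_one_self[of "e * t"] by linarith
        then have "t \<le> 1 / e * exp (e * t)" using e by (simp add: field_simps)
        moreover have "1 \<le> exp (e * t)" using e t by simp
        ultimately show ?thesis unfolding distrib_right by linarith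
      qed
      then have "C * (1 + t) * exp (a * t) \<le> C * ((1 + 1 / e) * exp (e * t)) * exp (a * t)"
        using C by (intro mult_right_mono mult_left_mono) auto
      moreover have "exp ((a + e) * t) = exp (e * t) * exp (a * t)"
        by (simp add: algebra_simps flip: exp_add)
      ultimately show ?thesis using upper[OF t] by (simp only: mult.assoc)
    qed
    then have "a + e \<in> ?\<Omega>"
      using C e by (intro CollectI exI[of _ "C * (1 + 1 / e)"]) auto
    then show "Inf (ereal ` ?\<Omega>) \<le> ereal a + ereal e"
      by (intro Inf_lower) auto
  qed
  show "ereal a \<le> Inf (ereal ` ?\<Omega>)"
  proof (rule Inf_greatest, clarify)
    fix \<omega> M assume M: "M \<ge> 0" "\<forall>t\<ge>0. norm (T t) \<le> M * exp (\<omega> * t)"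
    have "a \<le> \<omega>"
    proof (rule ccontr)
      assume "\<not> a \<le> \<omega>"
      then have d: "a - \<omega> > 0" by simp
      \<comment> \<open>then the bound gives \<open>exp M \<le> M\<close>\<close>
      define t where "t = M / (a - \<omega>)"
      have t: "t \<ge> 0" using d M by (simp add: t_def)
      have "exp (a * t) \<le> M * exp (\<omega> * t)" using lower[OF t] M t by force
      then have "exp ((a - \<omega>) * t) \<le> M" by (simp add: left_diff_distrib exp_diff field_simps)
      moreover have "(a - \<omega>) * t = M" using d by (simp add: t_def)
      ultimately show False using exp_ge_add_one_self[of M] by simp
    qed
    then show "ereal a \<le> ereal \<omega>" by simp
  qed
qed

theorem theorem4p1:
  fixes T S :: "real \<Rightarrow> (torus_h1 \<times> torus_l2) \<Rightarrow>\<^sub>L (torus_h1 \<times> torus_l2)"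
  assumes "C0_group T"
    and "generator T = {(x, - y) | x y. (x, y) \<in> wave_op}"
    and "\<And>t. S t = T (- t)"
  shows "growth_bound T = ereal (1 / 2) \<and> growth_bound S = ereal (1 / 2) \<and>
    (\<exists>C\<ge>0. \<forall>t. norm (T t) \<le> C * (1 + \<bar>t\<bar>) * exp (\<bar>t\<bar> / 2))"
proof (intro conjI)
  note lower = norm_group_ge[OF assms(1,2)] and upper = norm_group_le[OF assms(1,2)]
  show "growth_bound T = ereal (1 / 2)"
  proof (rule growth_bound_eqI)
    show "exp (1 / 2 * t) \<le> norm (T t)" if "t \<ge> 0" for t
      using lower[of t] that by simp
    show "norm (T t) \<le> 2 * (1 + t) * exp (1 / 2 * t)" if "t \<ge> 0" for t
      using upper[of t] that by simp
  qed
  show "growth_bound S = ereal (1 / 2)"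
  proof (rule growth_bound_eqI)
    show "exp (1 / 2 * t) \<le> norm (S t)" if "t \<ge> 0" for t
      using lower[of "- t"] that by (simp add: assms(3))
    show "norm (S t) \<le> 2 * (1 + t) * exp (1 / 2 * t)" if "t \<ge> 0" for t
      using upper[of "- t"] that by (simp add: assms(3))
  qed
  show "\<exists>C\<ge>0. \<forall>t. norm (T t) \<le> C * (1 + \<bar>t\<bar>) * exp (\<bar>t\<bar> / 2)"
    using upper by (intro exI[of _ 2]) simp
qed

end
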